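(* Let $n\ge2$, $0\le\beta<n$, $1\le p_1,p_2,q<\infty$, $\alpha\in\mathbb{R}$, $n+\gamma>0$ and $\frac{\gamma+n}{p_2}=\frac{\alpha+n}{p_1}-\beta$. Let $\Phi$ be a measurable function on $\mathbb{R}^n$. Then, for all $f$ for which the right-hand side is finite, $$\|H_{\Phi,\beta}f\|_{\mathcal{W}L^{p_2}_{\rm rad}L^{q}_{\rm ang}(\mathbb{R}^n,r^\gamma)}\le\frac{\omega_{n-1}^{1/q}}{(n+\gamma)^{1/p_2}}\,\|\Phi\|_{L^{\infty}_{\rm ang}L^{p_1'}_{\rm rad}(\mathbb{R}^n,\,r^{\frac{(\gamma+n)p_1'}{p_2}-n})}\,\|f\|_{L^{p_1}_{\rm rad}L^{1}_{\rm ang}(\mathbb{R}^n,r^\alpha)} .$$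
   Context: $S^{n-1}$ is the unit sphere of $\mathbb{R}^n$ with (unnormalized) surface Lebesgue measure $d\sigma$, and $\omega_{n-1}=\sigma(S^{n-1})$. For $1\le p,\tilde p<\infty$ and a weight $w$ on $(0,\infty)$, $$\|f\|_{L^{p}_{\rm rad}L^{\tilde p}_{\rm ang}(\mathbb{R}^n,w)}=\Big(\int_0^\infty\Big(\int_{S^{n-1}}|f(r\theta)|^{\tilde p}d\sigma(\theta)\Big)^{p/\tilde p}r^{n-1}w(r)\,dr\Big)^{1/p};$$ $r^\gamma$ denotes the weight $w(r)=r^\gamma$. $p_1'$ is the conjugate exponent of $p_1$. The norm of $\Phi$ is $$\|\Phi\|_{L^{\infty}_{\rm ang}L^{p_1'}_{\rm rad}(\mathbb{R}^n,\,r^{\frac{(\gamma+n)p_1'}{p_2}-n})}=\operatorname*{ess\,sup}_{\theta\in S^{n-1}}\Big(\int_0^\infty|\Phi(t\theta)|^{p_1'}t^{\frac{(\gamma+n)p_1'}{p_2}-1}dt\Big)^{1/p_1'},$$ with the inner expression replaced by $\operatorname*{ess\,sup}_{t>0}|\Phi(t\theta)|t^{(\gamma+n)/p_2}$ when $p_1=1$. The weak mixed norm is $$\|g\|_{\mathcal{W}L^{p_2}_{\rm rad}L^{q}_{\rm ang}(\mathbb{R}^n,r^\gamma)}=\sup_{\lambda>0}\lambda\,\big\|\chi_{\{x\in\mathbb{R}^n:|g(x)|>\lambda\}}\big\|_{L^{p_2}_{\rm rad}L^{q}_{\rm ang}(\mathbb{R}^n,r^\gamma)} .$$ The $n$-dimensional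 fractional Hausdorff operator is $$H_{\Phi,\beta}f(x)=\int_{\mathbb{R}^n}\frac{\Phi(x|y|^{-1})}{|y|^{n-\beta}}f(y)\,dy .$$ *)

theory Defs
  imports "HOL-Analysis.Analysis" "HOL-Probability.Essential_Supremum"
begin

text \<open>
  Unnormalized surface measure on the unit sphere of an \<open>n\<close>-dimensional Euclidean space, given by
  the cone formula: \<open>\<sigma>(A)\<close> is \<open>n\<close> times the volume of the cone
  \<open>{r\<theta> | 0 < r < 1, \<theta> \<in> A}\<close> (see \<open>emeasure_surface_measure\<close> below). The measure is completed,
  because the restriction of a Lebesgue measurable function to almost every sphere is
  measurable only for the completed measure.
\<close>

definition surface_measure :: "'a::euclidean_space measure" where
  "surface_measure = completion (scale_measure (of_nat DIM('a))
     (distr (restrict_space lborel (ball 0 1 - {0})) (restrict_space borel (sphere 0 1))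
       (\<lambda>x. x /\<^sub>R norm x)))"

lemma space_surface_measure [simp]: "space (surface_measure :: 'a::euclidean_space measure) = sphere 0 1"
  by (simp add: surface_measure_def space_scale_measure space_restrict_space)

lemma emeasure_surface_measure:
  fixes A :: "'a::euclidean_space set"
  assumes "A \<in> sets borel" "A \<subseteq> sphere 0 1"
  shows "emeasure surface_measure A =
    of_nat DIM('a) * emeasure lborel {x. 0 < norm x \<and> norm x < 1 \<and> x /\<^sub>R norm x \<in> A}"
proof -
  let ?R = "restrict_space lborel (ball 0 1 - {0}) :: 'a measure"
  let ?S = "restrict_space borel (sphere 0 1) :: 'a measure"
  let ?D = "scale_measure (of_nat DIM('a)) (distr ?R ?S (\<lambda>x. x /\<^sub>R norm x))"
  have meas: "(\<lambda>x. x /\<^sub>R norm x) \<in> measurable ?R ?S"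
    by (intro measurable_restrict_space2 measurable_restrict_space1)
      (auto simp: space_restrict_space)
  have A: "A \<in> sets ?S"
    using assms by (auto simp: sets_restrict_space_iff)
  have eq: "(\<lambda>x. x /\<^sub>R norm x) -` A \<inter> space ?R
      = {x. 0 < norm x \<and> norm x < 1 \<and> x /\<^sub>R norm x \<in> A}"
    by (auto simp: space_restrict_space)
  have "emeasure surface_measure A = emeasure ?D A"
    unfolding surface_measure_def using A by (simp add: emeasure_completion main_part_sets)
  also have "\<dots> = of_nat DIM('a) * emeasure ?R {x. 0 < norm x \<and> norm x < 1 \<and> x /\<^sub>R norm x \<in> A}"
    using A by (simp only: emeasure_scale_measure emeasure_distr[OF meas] eq)
  also have "emeasure ?R {x. 0 < norm x \<and> norm x < 1 \<and> x /\<^sub>R norm x \<in> A}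
      = emeasure lborel {x. 0 < norm x \<and> norm x < 1 \<and> x /\<^sub>R norm x \<in> A}"
    by (rule emeasure_restrict_space) auto
  finally show ?thesis .
qed

text \<open>Powers of extended nonnegative reals; only positive exponents \<open>a\<close> are used.\<close>

definition enn_powr :: "ennreal \<Rightarrow> real \<Rightarrow> ennreal" where
  "enn_powr x a = (if x = \<infinity> then \<infinity> else ennreal (enn2real x powr a))"

definition mixed_norm ::
    "real \<Rightarrow> real \<Rightarrow> (real \<Rightarrow> real) \<Rightarrow> ('a::euclidean_space \<Rightarrow> 'b::real_normed_vector) \<Rightarrow> ennreal" where
  "mixed_norm p s w f =
     enn_powr
       (\<integral>\<^sup>+r\<in>{0<..}.
          enn_powr (\<integral>\<^sup>+\<theta>. ennreal (norm (f (r *\<^sub>R \<theta>)) powr s) \<partial>surface_measure) (p / s)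
            * ennreal (r ^ (DIM('a) - 1) * w r) \<partial>lebesgue)
       (1 / p)"

definition weak_mixed_norm ::
    "real \<Rightarrow> real \<Rightarrow> (real \<Rightarrow> real) \<Rightarrow> ('a::euclidean_space \<Rightarrow> 'b::real_normed_vector) \<Rightarrow> ennreal" where
  "weak_mixed_norm p s w g =
     (SUP l\<in>{0<..}. ennreal l * mixed_norm p s w (indicator {x. norm (g x) > l} :: 'a \<Rightarrow> real))"

definition conj_exponent :: "real \<Rightarrow> real" where
  "conj_exponent p = p / (p - 1)"

text \<open>
  The norm of the kernel in \<open>L\<^sup>\<infinity>_ang L^{p1'}_rad\<close> with weight \<open>r^{(\<gamma>+n)p1'/p2 - n}\<close>.
  For \<open>p1 = 1\<close>, where \<open>p1' = \<infinity>\<close>, the radial norm is a weighted essential supremum.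
\<close>

definition kernel_norm ::
    "real \<Rightarrow> real \<Rightarrow> real \<Rightarrow> ('a::euclidean_space \<Rightarrow> 'b::real_normed_vector) \<Rightarrow> ennreal" where
  "kernel_norm p1 p2 \<gamma> \<Phi> =
     esssup surface_measure (\<lambda>\<theta>.
       if p1 = 1
       then esssup (lebesgue_on {0<..})
              (\<lambda>t. ennreal (norm (\<Phi> (t *\<^sub>R \<theta>)) * t powr ((\<gamma> + real DIM('a)) / p2)))
       else enn_powr
              (\<integral>\<^sup>+t\<in>{0<..}. ennreal (norm (\<Phi> (t *\<^sub>R \<theta>)) powr conj_exponent p1
                  * t powr ((\<gamma> + real DIM('a)) * conj_exponent p1 / p2 - 1)) \<partial>lebesgue)
              (1 / conj_exponent p1))"

definition hausdorff_integrand ::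
    "('a::euclidean_space \<Rightarrow> complex) \<Rightarrow> real \<Rightarrow> ('a \<Rightarrow> complex) \<Rightarrow> 'a \<Rightarrow> 'a \<Rightarrow> complex" where
  "hausdorff_integrand \<Phi> \<beta> f x y =
     \<Phi> (x /\<^sub>R norm y) / of_real (norm y powr (real DIM('a) - \<beta>)) * f y"

definition hausdorff_op ::
    "('a::euclidean_space \<Rightarrow> complex) \<Rightarrow> real \<Rightarrow> ('a \<Rightarrow> complex) \<Rightarrow> 'a \<Rightarrow> complex" where
  "hausdorff_op \<Phi> \<beta> f x = (\<integral>y. hausdorff_integrand \<Phi> \<beta> f x y \<partial>lebesgue)"

end

theory Submission
  imports Defs
begin

text \<open>
  In polar coordinates the angular variable of \<open>y\<close> enters the operator only through \<open>f\<close>, so on the ray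
  through a unit vector \<open>\<theta>\<close> the operator is dominated by the Mellin convolution of
  \<open>|\<Phi>(\<cdot>\<theta>)|\<close> with the spherical means of \<open>|f|\<close>. Hoelder's inequality and the
  scaling condition give, for almost every \<open>\<theta>\<close> and every \<open>r > 0\<close>, the bound
  \<open>|H f(r\<theta>)| \<le> r powr (-(\<gamma> + n)/p2) * C\<close>, where \<open>C\<close> is the product of the two norms. Hence each
  superlevel set of \<open>|H f|\<close> lies, up to a null set of directions, in a ball centred at the origin, whose
  weighted mixed norm is explicit.
\<close>

text \<open>The obstacle is measurability along rays: \<open>\<Phi>\<close> and \<open>f\<close> are
  only Lebesgue measurable, and a single ray is a null set. Both are replaced by Borel
  representatives, for which Tonelli applies, and the error must be controlled ray by ray. This
  works because the kernel at \<open>r *\<^sub>R \<theta>\<close> sees \<open>y\<close> only through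
  r/|y|: once \<open>\<Phi>\<close> agrees with its representative almost everywhere on the ray
  through \<open>\<theta>\<close>, the substitution t = r/|y| makes the integrands agree for every r
  > 0. The exceptional set is thus a cone over a null set of directions, which meets every sphere
  about the origin, and not just almost every one, in a null set.

  The constant comes from the ball. If R is the radius at which R^(-(\<gamma>+n)/p2) C equals the
  level \<lambda>, then R^(n+\<gamma>) = (C/\<lambda>)^p2. The p2-th root of \<omega>^(p2/q)
  R^(n+\<gamma>)/(n+\<gamma>), where \<omega> is the area of the unit sphere, is \<omega>^(1/q)
  (n+\<gamma>)^(-1/p2) C/\<lambda>, and the factor \<lambda> of the weak norm cancels.\<close>

section \<open>Polar coordinates\<close>

text \<open>The surface measure before completion: Tonelli's theorem is applied to it, because product
  measures of completed measures are not complete.\<close>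

definition sphere_measure :: "'a::euclidean_space measure" where
  "sphere_measure = scale_measure (of_nat DIM('a))
     (distr (restrict_space lborel (ball 0 1 - {0})) (restrict_space borel (sphere 0 1))
       (\<lambda>x. x /\<^sub>R norm x))"

lemma surface_measure_eq: "surface_measure = completion sphere_measure"
  by (simp add: surface_measure_def sphere_measure_def)

lemma sets_sphere_measure [measurable_cong]:
  "sets (sphere_measure :: 'a::euclidean_space measure) = sets (restrict_space borel (sphere 0 1))"
  by (simp add: sphere_measure_def sets_scale_measure)

lemma space_sphere_measure [simp]:
  "space (sphere_measure :: 'a::euclidean_space measure) = sphere 0 1"
  by (simp add: sphere_measure_def space_scale_measure space_restrict_space)

lemma emeasure_sphere_measure:
  fixes A :: "'a::euclidean_space set"
  assumes "A \<in> sets sphere_measure"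
  shows "emeasure sphere_measure A =
    of_nat DIM('a) * emeasure lborel {x. 0 < norm x \<and> norm x < 1 \<and> x /\<^sub>R norm x \<in> A}"
proof -
  have "emeasure sphere_measure A = emeasure surface_measure A"
    using assms by (simp add: surface_measure_eq main_part_sets)
  with assms show ?thesis
    by (subst (asm) emeasure_surface_measure) (auto simp: sets_sphere_measure sets_restrict_space_iff)
qed

lemma emeasure_sphere_measure_finite:
  "emeasure (sphere_measure :: 'a::euclidean_space measure) (sphere 0 1) < \<infinity>"
proof -
  have "emeasure lborel {x::'a. 0 < norm x \<and> norm x < 1 \<and> x /\<^sub>R norm x \<in> sphere 0 1}
      \<le> emeasure lborel (ball (0::'a) 1)"
    by (rule emeasure_mono) auto
  also have "\<dots> < \<infinity>"
    using emeasure_lborel_ball_finite by (simp add: less_top)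
  finally show ?thesis
    by (subst emeasure_sphere_measure)
      (auto simp: sets_sphere_measure sets_restrict_space_iff ennreal_mult_less_top of_nat_less_top)
qed

lemma finite_measure_sphere_measure: "finite_measure (sphere_measure :: 'a::euclidean_space measure)"
  using emeasure_sphere_measure_finite[where 'a='a] by (intro finite_measureI) simp

text \<open>The Jacobian is part of the measure, so that polar coordinates become the image of a
  product measure and Fubini arguments apply to integrals and null sets alike.\<close>

definition radial_measure :: "nat \<Rightarrow> real measure" where
  "radial_measure n = density lborel (\<lambda>r. ennreal (r ^ (n - 1)) * indicator {0<..} r)"

lemma sets_radial_measure [measurable_cong]: "sets (radial_measure n) = sets borel"
  by (simp add: radial_measure_def)

lemma sigma_finite_radial_measure: "sigma_finite_measure (radial_measure n)"
  unfolding radial_measure_def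
  by (subst sigma_finite_measure.sigma_finite_iff_density_finite[OF sigma_finite_lborel]) (auto simp: ennreal_mult_eq_top_iff indicator_def)

text \<open>Half-lines are the generator on which the radial measure is compared with the
  distribution of the norm; \<open>max 0 a\<close> treats both signs of \<open>a\<close> at
  once.\<close>

lemma emeasure_radial_measure_lessThan:
  assumes "n > 0"
  shows "emeasure (radial_measure n) {..<a} = ennreal (max 0 a ^ n / n)"
proof -
  have "emeasure (radial_measure n) {..<a} =
      (\<integral>\<^sup>+r. ennreal (r ^ (n - 1)) * indicator {0<..} r * indicator {..<a} r \<partial>lborel)"
    unfolding radial_measure_def by (rule emeasure_density) auto
  also have "\<dots> = (\<integral>\<^sup>+r. ennreal (r ^ (n - 1)) * indicator {0..max 0 a} r \<partial>lborel)"
    using AE_lborel_singleton[of 0] AE_lborel_singleton[of a]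
    by (intro nn_integral_cong_AE, eventually_elim) (auto simp: indicator_def)
  also have "\<dots> = ennreal (max 0 a ^ n / n - 0 ^ n / n)"
  proof (rule nn_integral_FTC_Icc)
    fix x :: real assume x: "x \<in> {0..max 0 a}"
    show "((\<lambda>x. x ^ n / real n) has_real_derivative x ^ (n - 1)) (at x)"
      using assms by (auto intro!: derivative_eq_intros)
    show "0 \<le> x ^ (n - 1)" using x by simp
  qed auto
  finally show ?thesis
    using assms by (simp add: power_0_left)
qed

lemma measurable_sphere_measure_ident [measurable]: "(\<lambda>\<theta>. \<theta>) \<in> sphere_measure \<rightarrow>\<^sub>M borel"
  by (simp add: measurable_cong_sets[OF sets_sphere_measure refl] measurable_restrict_space1)

lemma measurable_polar [measurable]:
  "(\<lambda>(r, \<theta>). r *\<^sub>R \<theta>) \<in> radial_measure n \<Otimes>\<^sub>M sphere_measure \<rightarrow>\<^sub>M borel"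
  by measurable

text \<open>By homogeneity of Lebesgue measure, the cone of height \<open>a\<close> over a set of
  directions has \<open>a ^ DIM('a)\<close> times the volume of the cone of height 1, which is the
  measure of the directions up to the factor \<open>DIM('a)\<close>. This gives the product formula
  on rectangles, so the product measure is the image of \<open>lborel\<close> under x \<mapsto>
  (|x|, x/|x|), and (r, \<theta>) \<mapsto> r\<theta> undoes that map.\<close>

lemma lborel_eq_polar:
  "distr (radial_measure DIM('a) \<Otimes>\<^sub>M sphere_measure) borel (\<lambda>(r, \<theta>). r *\<^sub>R \<theta>)
    = (lborel :: 'a::euclidean_space measure)"
proof -
  obtain e :: 'a where e: "norm e = 1"
    using vector_choose_size[of 1] by auto
  \<comment> \<open>The origin gets an arbitrary unit vector, so that \<open>h\<close> maps into the
    sphere everywhere and \<open>norm x *\<^sub>R h x = x\<close> holds without exception.\<close>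
  define h where "h x = (if x = 0 then e else x /\<^sub>R norm x)" for x :: 'a
  have h_S [measurable]: "h \<in> borel \<rightarrow>\<^sub>M restrict_space borel (sphere 0 1)"
    unfolding h_def using e by (intro measurable_restrict_space2) auto
  let ?S = "sphere_measure :: 'a measure" and ?R = "radial_measure DIM('a)"
  have rect: "emeasure ?R A * emeasure ?S B = emeasure lborel {x. norm x \<in> A \<and> h x \<in> B}"
    if A: "A \<in> sets borel" and B: "B \<in> sets ?S" for A B
  proof -
    have B' [measurable]: "B \<in> sets (restrict_space borel (sphere 0 1))"
      using B by (simp add: sets_sphere_measure)
    have C [measurable]: "{x. h x \<in> B} \<in> sets borel"
      using measurable_sets[OF h_S B'] by (simp add: vimage_def)
    \<comment> \<open>With \<open>B\<close> fixed, both sides of the product formula are measures in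
      \<open>A\<close>; they are compared on the intersection-stable family of half-lines.\<close>
    define N where "N = distr (restrict_space lborel {x. h x \<in> B}) borel norm"
    have m: "norm \<in> restrict_space lborel {x. h x \<in> B} \<rightarrow>\<^sub>M borel"
      by (intro measurable_restrict_space1) auto
    have N: "emeasure N X = emeasure lborel {x. norm x \<in> X \<and> h x \<in> B}" if [measurable]: "X \<in> sets borel" for X
      unfolding N_def
      by (subst emeasure_distr[OF m that], subst emeasure_restrict_space)
        (auto simp: space_restrict_space intro!: arg_cong[where f="emeasure _"])
    have "scale_measure (emeasure ?S B) ?R = N"
    proof (rule measure_eqI_generator_eq[where \<Omega>=UNIV and E="range lessThan" and A="\<lambda>i. {..<real i}"])
      show "Int_stable (range (lessThan :: real \<Rightarrow> _))"
        by (auto simp: Int_stable_def greaterThan_Int_greaterThan)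
      show "sets (scale_measure (emeasure ?S B) ?R) = sigma_sets UNIV (range lessThan)"
        by (simp add: sets_scale_measure sets_radial_measure borel_Iio)
      show "sets N = sigma_sets UNIV (range lessThan)"
        by (simp add: N_def borel_Iio)
      show "(\<Union>i. {..<real i}) = UNIV"
        by (auto intro: reals_Archimedean2)
      have fin: "emeasure ?S B \<noteq> \<infinity>"
        using finite_measure.emeasure_finite[OF finite_measure_sphere_measure] by (simp add: top_unique)
      show "emeasure (scale_measure (emeasure ?S B) ?R) {..<real i} \<noteq> \<infinity>" for i
        using fin
        by (simp add: emeasure_scale_measure sets_radial_measure emeasure_radial_measure_lessThan
            ennreal_mult_eq_top_iff)
      fix X :: "real set" assume "X \<in> range lessThan"
      then obtain a where X: "X = {..<a}" by auto
      \<comment> \<open>\<open>D\<close> is the truncated cone that defines the surface measure of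
        \<open>B\<close>.\<close>
      define D where "D = {x. 0 < norm x \<and> norm x < 1 \<and> x /\<^sub>R norm x \<in> B}"
      have "D = {x. 0 < norm x \<and> norm x < 1} \<inter> {x. h x \<in> B}"
        by (auto simp: D_def h_def)
      then have D [measurable]: "D \<in> sets borel"
        by simp
      have e1: "emeasure lborel {x. norm x \<in> X \<and> h x \<in> B} = ennreal (max 0 a ^ DIM('a)) * emeasure lborel D"
      proof (cases "a > 0")
        case True
        \<comment> \<open>Dilation by \<open>a\<close> carries the unit cone onto the cone of height
          \<open>a\<close>. The origin is removed because the value chosen for \<open>h 0\<close>
          may lie in \<open>B\<close>; it is a null point.\<close>
        have 1: "(\<lambda>x. a *\<^sub>R x + 0) ` D = {x. norm x \<in> X \<and> h x \<in> B} - {0}"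
        proof (intro equalityI subsetI)
          fix x assume x: "x \<in> {x. norm x \<in> X \<and> h x \<in> B} - {0}"
          then show "x \<in> (\<lambda>x. a *\<^sub>R x + 0) ` D"
            using True by (intro image_eqI[of _ _ "x /\<^sub>R a"]) (auto simp: D_def X h_def field_simps)
        next
          fix y assume "y \<in> (\<lambda>x. a *\<^sub>R x + 0) ` D"
          then obtain x where x: "y = a *\<^sub>R x" "x \<in> D" by auto
          then have "y /\<^sub>R norm y = x /\<^sub>R norm x"
            using True by (simp add: field_simps)
          moreover have "norm y = a * norm x" "y \<noteq> 0"
            using x True by (auto simp: D_def)
          ultimately show "y \<in> {x. norm x \<in> X \<and> h x \<in> B} - {0}"
            using x(2) True by (auto simp: D_def X h_def)
        qed
        have "emeasure lborel {x. norm x \<in> X \<and> h x \<in> B} = emeasure lborel ({x. norm x \<in> X \<and> h x \<in> B} - {0})"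
          by (rule emeasure_Diff_null_set[symmetric]) (auto simp: X)
        also have "\<dots> = emeasure lebesgue ({x. norm x \<in> X \<and> h x \<in> B} - {0})"
          by (subst emeasure_completion) (auto simp: X main_part_sets)
        also have "\<dots> = ennreal (max 0 a ^ DIM('a)) * emeasure lebesgue D"
          using True unfolding 1[symmetric] by (subst emeasure_lebesgue_affine) auto
        finally show ?thesis
          by (simp add: main_part_sets)
      next
        case False
        then have "{x. norm x \<in> X \<and> h x \<in> B} = {}"
          by (auto simp: X)
            (metis less_le_trans norm_ge_zero not_less)
        then show ?thesis using False by (simp only:) (simp add: max_def)
      qed
      have e2: "emeasure ?S B = of_nat DIM('a) * emeasure lborel D"
        using emeasure_sphere_measure[OF B] by (simp add: D_def)
      \<comment> \<open>The factor \<open>DIM('a)\<close> in the cone formula cancels the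
        denominator produced by integrating \<open>r ^ (DIM('a) - 1)\<close>.\<close>
      have e3: "ennreal (max 0 a ^ DIM('a) / DIM('a)) * of_nat DIM('a) = ennreal (max 0 a ^ DIM('a))"
        unfolding ennreal_of_nat_eq_real_of_nat by (simp flip: ennreal_mult)
      have "emeasure lborel {x. norm x \<in> X \<and> h x \<in> B}
          = emeasure ?S B * ennreal (max 0 a ^ DIM('a) / DIM('a))"
        unfolding e1 e2 e3[symmetric] by (simp only: mult_ac)
      then show "emeasure (scale_measure (emeasure ?S B) ?R) X = emeasure N X"
        by (simp add: X N emeasure_radial_measure_lessThan)
    qed auto
    then have "emeasure N A = emeasure (scale_measure (emeasure ?S B) ?R) A"
      by simp
    with A show ?thesis
      by (simp add: N mult.commute)
  qed
  have hm [measurable]: "(\<lambda>x. (norm x, h x)) \<in> lborel \<rightarrow>\<^sub>M ?R \<Otimes>\<^sub>M ?S"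
    by (intro measurable_Pair) (simp_all add: measurable_cong_sets[OF _ sets_radial_measure]
      measurable_cong_sets[OF _ sets_sphere_measure])
  have P: "?R \<Otimes>\<^sub>M ?S = distr lborel (?R \<Otimes>\<^sub>M ?S) (\<lambda>x. (norm x, h x))"
  proof (rule pair_measure_eqI)
    fix A B assume AB: "A \<in> sets ?R" "B \<in> sets ?S"
    show "emeasure ?R A * emeasure ?S B
      = emeasure (distr lborel (?R \<Otimes>\<^sub>M ?S) (\<lambda>x. (norm x, h x))) (A \<times> B)"
      using AB by (subst emeasure_distr[OF hm])
       (auto simp: rect sets_radial_measure vimage_def)
  qed (auto intro: sigma_finite_radial_measure finite_measure.axioms(1) finite_measure_sphere_measure)
  have rm: "(\<lambda>(r, \<theta>). r *\<^sub>R \<theta>) \<in> ?R \<Otimes>\<^sub>M ?S \<rightarrow>\<^sub>M borel"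
    by (rule measurable_polar)
  have "distr (?R \<Otimes>\<^sub>M ?S) borel (\<lambda>(r, \<theta>). r *\<^sub>R \<theta>)
      = distr (distr lborel (?R \<Otimes>\<^sub>M ?S) (\<lambda>x. (norm x, h x))) borel (\<lambda>(r, \<theta>). r *\<^sub>R \<theta>)"
    by (rule arg_cong[OF P])
  also have "\<dots> = distr lborel borel ((\<lambda>(r, \<theta>). r *\<^sub>R \<theta>) \<circ> (\<lambda>x. (norm x, h x)))"
    using rm hm by (rule distr_distr)
  also have "\<dots> = distr lborel borel (\<lambda>x. x)"
    by (rule distr_cong) (auto simp: h_def)
  finally show ?thesis
    by (simp add: distr_id2)
qed

section \<open>Integrals and null sets in polar coordinates\<close>

lemma pair_sigma_finite_polar:
  "pair_sigma_finite (radial_measure n) (sphere_measure :: 'a::euclidean_space measure)"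
  by (intro pair_sigma_finite.intro sigma_finite_radial_measure
      finite_measure.axioms(1) finite_measure_sphere_measure)

lemma nn_integral_radial_measure:
  assumes [measurable]: "g \<in> borel_measurable borel"
  shows "(\<integral>\<^sup>+r. g r \<partial>radial_measure n)
    = (\<integral>\<^sup>+r\<in>{0<..}. g r * ennreal (r ^ (n - 1)) \<partial>lborel)"
  unfolding radial_measure_def by (subst nn_integral_density) (auto simp: mult_ac)

lemma AE_radial_measure:
  "(AE r in radial_measure n. P r) \<longleftrightarrow> (AE r in lborel. r > 0 \<longrightarrow> P r)"
  unfolding radial_measure_def
  by (subst AE_density) (auto simp: indicator_def intro!: AE_cong)

lemma measurable_nn_integral_sphere [measurable]:
  assumes [measurable]: "g \<in> borel_measurable (borel :: 'a::euclidean_space measure)"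
  shows "(\<lambda>r. \<integral>\<^sup>+\<theta>. g (r *\<^sub>R \<theta>) \<partial>sphere_measure) \<in> borel_measurable borel"
proof -
  interpret finite_measure "sphere_measure :: 'a measure"
    by (rule finite_measure_sphere_measure)
  show ?thesis
    by (rule borel_measurable_nn_integral) measurable
qed

lemma nn_integral_polar:
  assumes [measurable]: "g \<in> borel_measurable (borel :: 'a::euclidean_space measure)"
  shows "(\<integral>\<^sup>+x. g x \<partial>lborel)
    = (\<integral>\<^sup>+r\<in>{0<..}. (\<integral>\<^sup>+\<theta>. g (r *\<^sub>R \<theta>) \<partial>sphere_measure) * ennreal (r ^ (DIM('a) - 1)) \<partial>lborel)"
proof -
  interpret pair_sigma_finite "radial_measure DIM('a)" "sphere_measure :: 'a measure"
    by (rule pair_sigma_finite_polar)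
  have "(\<integral>\<^sup>+x. g x \<partial>lborel)
      = (\<integral>\<^sup>+z. g (fst z *\<^sub>R snd z) \<partial>(radial_measure DIM('a) \<Otimes>\<^sub>M sphere_measure))"
    by (subst lborel_eq_polar[symmetric], subst nn_integral_distr) (auto simp: case_prod_beta)
  also have "\<dots> = (\<integral>\<^sup>+r. (\<integral>\<^sup>+\<theta>. g (r *\<^sub>R \<theta>) \<partial>sphere_measure) \<partial>radial_measure DIM('a))"
    by (subst M2.nn_integral_fst[symmetric]) auto
  also have "\<dots> = (\<integral>\<^sup>+r\<in>{0<..}. (\<integral>\<^sup>+\<theta>. g (r *\<^sub>R \<theta>) \<partial>sphere_measure) * ennreal (r ^ (DIM('a) - 1)) \<partial>lborel)"
    by (rule nn_integral_radial_measure) measurable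
  finally show ?thesis .
qed

text \<open>Fubini for null sets, applied to a Borel null set that covers the exceptions. The first
  order serves the spherical means of \<open>f\<close>, the second the restriction of
  \<open>\<Phi>\<close> to rays.\<close>

lemma AE_polar:
  fixes P :: "'a::euclidean_space \<Rightarrow> bool"
  assumes "AE x in lborel. P x"
  shows "AE r in lborel. r > 0 \<longrightarrow> (AE \<theta> in sphere_measure. P (r *\<^sub>R \<theta>))"
    and "AE \<theta> in sphere_measure. AE r in lborel. r > 0 \<longrightarrow> P (r *\<^sub>R \<theta>)"
proof -
  interpret pair_sigma_finite "radial_measure DIM('a)" "sphere_measure :: 'a measure"
    by (rule pair_sigma_finite_polar)
  obtain N where N: "{x. \<not> P x} \<subseteq> N" "N \<in> null_sets lborel"
    using assms by (auto simp: eventually_ae_filter)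
  then have [measurable]: "N \<in> sets borel" by auto
  have "AE x in distr (radial_measure DIM('a) \<Otimes>\<^sub>M sphere_measure) borel (\<lambda>(r, \<theta>). r *\<^sub>R \<theta>). x \<notin> N"
    unfolding lborel_eq_polar using N(2) by (rule AE_not_in)
  then have pair: "AE z in radial_measure DIM('a) \<Otimes>\<^sub>M sphere_measure. fst z *\<^sub>R snd z \<notin> N"
    by (subst (asm) AE_distr_iff) (auto simp: case_prod_beta)
  then have 1: "AE r in radial_measure DIM('a). AE \<theta> in sphere_measure. r *\<^sub>R \<theta> \<notin> N"
    using AE_pair by fastforce
  have [measurable]: "Measurable.pred (radial_measure DIM('a) \<Otimes>\<^sub>M sphere_measure) (\<lambda>z. fst z *\<^sub>R snd z \<notin> N)"
    by measurable
  have 2: "AE \<theta> in sphere_measure. AE r in radial_measure DIM('a). r *\<^sub>R \<theta> \<notin> N"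
    using 1 by (subst AE_commute[symmetric]) auto
  show "AE r in lborel. r > 0 \<longrightarrow> (AE \<theta> in sphere_measure. P (r *\<^sub>R \<theta>))"
    using 1 unfolding AE_radial_measure
    by eventually_elim (use N(1) in \<open>auto elim!: eventually_mono\<close>)
  show "AE \<theta> in sphere_measure. AE r in lborel. r > 0 \<longrightarrow> P (r *\<^sub>R \<theta>)"
    using 2 unfolding AE_radial_measure
    by eventually_elim (use N(1) in \<open>auto elim!: eventually_mono\<close>)
qed

text \<open>The cone over a null set of directions is a null set: its slice by each sphere about the
  origin has measure zero. This carries statements about rays back to points of the space.\<close>

lemma AE_lborel_rayI:
  fixes P :: "'a::euclidean_space \<Rightarrow> bool"
  assumes "AE \<theta> in sphere_measure. \<forall>r>0. P (r *\<^sub>R \<theta>)"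
  shows "AE x in lborel. P x"
proof -
  obtain N where N: "{\<theta>\<in>sphere 0 1. \<not> (\<forall>r>0. P (r *\<^sub>R \<theta>))} \<subseteq> N" "N \<in> null_sets sphere_measure"
    using assms by (auto simp: eventually_ae_filter)
  then have "N \<in> sets (restrict_space borel (sphere 0 1))"
    by (metis null_setsD2 sets_sphere_measure)
  then have [measurable]: "N \<in> sets borel" and sub: "N \<subseteq> sphere 0 1"
    by (auto simp: sets_restrict_space_iff)
  let ?C = "{x::'a. x /\<^sub>R norm x \<in> N}"
  have [measurable]: "?C \<in> sets borel" by measurable
  have "emeasure lborel ?C = (\<integral>\<^sup>+x. indicator ?C x \<partial>lborel)"
    by (simp add: nn_integral_indicator)
  also have "\<dots> = (\<integral>\<^sup>+r\<in>{0<..}. (\<integral>\<^sup>+\<theta>. indicator ?C (r *\<^sub>R \<theta>) \<partial>sphere_measure)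
      * ennreal (r ^ (DIM('a) - 1)) \<partial>lborel)"
    by (rule nn_integral_polar) measurable
  also have "\<dots> = (\<integral>\<^sup>+(r::real). 0 \<partial>lborel)"
  proof (rule nn_integral_cong)
    fix r :: real
    have "(\<integral>\<^sup>+\<theta>. indicator ?C (r *\<^sub>R \<theta>) \<partial>sphere_measure) = (\<integral>\<^sup>+\<theta>. indicator N \<theta> \<partial>sphere_measure)" if "r > 0"
      using that by (intro nn_integral_cong) (auto simp: indicator_def)
    also have "(\<integral>\<^sup>+\<theta>. indicator N \<theta> \<partial>sphere_measure) = 0"
      using N(2) by (simp add: null_setsD1 null_setsD2)
    finally show "(\<integral>\<^sup>+\<theta>. indicator ?C (r *\<^sub>R \<theta>) \<partial>sphere_measure) * ennreal (r ^ (DIM('a) - 1))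
        * indicator {0<..} r = 0"
      by (auto simp: indicator_def)
  qed
  finally have "?C \<in> null_sets lborel" by auto
  then have "AE x in lborel. x \<notin> ?C" by (rule AE_not_in)
  \<comment> \<open>The origin lies on no open ray, so the hypothesis says nothing about it and it
    is discarded separately.\<close>
  with AE_lborel_singleton[of 0] show ?thesis
  proof eventually_elim
    case (elim x)
    then have "x /\<^sub>R norm x \<in> sphere 0 1" "norm x > 0" by auto
    with N(1) elim(2) have "P (norm x *\<^sub>R (x /\<^sub>R norm x))" by blast
    then show ?case using elim by simp
  qed
qed


text \<open>The spheres whose radii form a null set fill only a null set. It applies to the kernel
  factor, which depends on \<open>y\<close> only through its norm.\<close>

lemma AE_lborel_normI:
  assumes "AE s in lborel. s > 0 \<longrightarrow> Q s"
  shows "AE y in (lborel :: 'a::euclidean_space measure). y \<noteq> 0 \<longrightarrow> Q (norm y)"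
proof -
  obtain N where N: "{s. \<not> (s > 0 \<longrightarrow> Q s)} \<subseteq> N" "N \<in> null_sets lborel"
    using assms by (auto simp: eventually_ae_filter)
  then have [measurable]: "N \<in> sets borel" by auto
  let ?C = "{y::'a. norm y \<in> N}"
  have [measurable]: "?C \<in> sets borel" by measurable
  have "emeasure lborel ?C = (\<integral>\<^sup>+x. indicator ?C x \<partial>lborel)"
    by (simp add: nn_integral_indicator)
  also have "\<dots> = (\<integral>\<^sup>+r\<in>{0<..}. (\<integral>\<^sup>+\<theta>. indicator ?C (r *\<^sub>R \<theta>) \<partial>sphere_measure)
      * ennreal (r ^ (DIM('a) - 1)) \<partial>lborel)"
    by (rule nn_integral_polar) measurable
  also have "\<dots> = (\<integral>\<^sup>+(r::real). 0 \<partial>lborel)"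
  proof (rule nn_integral_cong_AE)
    show "AE r in lborel. (\<integral>\<^sup>+\<theta>. indicator ?C (r *\<^sub>R \<theta>) \<partial>sphere_measure) * ennreal (r ^ (DIM('a) - 1))
        * indicator {0<..} r = 0"
      using AE_not_in[OF N(2)]
    proof eventually_elim
      case (elim r)
      have "(\<integral>\<^sup>+\<theta>. indicator ?C (r *\<^sub>R \<theta>) \<partial>sphere_measure) = (\<integral>\<^sup>+(\<theta>::'a). 0 \<partial>sphere_measure)" if "r > 0"
        using that elim by (intro nn_integral_cong) (auto simp: indicator_def)
      then show ?case by (auto simp: indicator_def)
    qed
  qed
  finally have "?C \<in> null_sets lborel" by auto
  then have "AE y in lborel. y \<notin> ?C" by (rule AE_not_in)
  then show ?thesis
  proof eventually_elim
    case (elim y)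
    then have "norm y \<notin> N" by simp
    with N(1) have "norm y > 0 \<longrightarrow> Q (norm y)" by blast
    then show ?case by simp
  qed
qed

section \<open>Powers and Hoelder's inequality in the extended nonnegative reals\<close>

lemma enn_powr_0 [simp]: "enn_powr 0 a = 0"
  by (simp add: enn_powr_def)

lemma enn_powr_top [simp]: "enn_powr top a = top"
  by (simp add: enn_powr_def)

lemma enn_powr_ennreal: "0 \<le> x \<Longrightarrow> enn_powr (ennreal x) a = ennreal (x powr a)"
  by (simp add: enn_powr_def)

lemma enn_powr_one_right [simp]: "enn_powr x 1 = x"
  by (cases x) (auto simp: enn_powr_ennreal)

lemma enn_powr_one_left [simp]: "enn_powr 1 a = 1"
  using enn_powr_ennreal[of 1 a] by simp

text \<open>True for every \<open>a\<close>, because \<open>0 powr a = 0\<close>; a vanishing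
  integral of a power thus forces the function itself to vanish almost everywhere.\<close>

lemma enn_powr_eq_0_iff [simp]: "enn_powr x a = 0 \<longleftrightarrow> x = 0"
  by (cases x) (auto simp: enn_powr_ennreal)

lemma enn_powr_mono:
  assumes "0 \<le> a" "x \<le> y"
  shows "enn_powr x a \<le> enn_powr y a"
proof (cases y)
  case (real b)
  then obtain c where "x = ennreal c" "0 \<le> c" "c \<le> b"
    using assms by (cases x) (auto simp: top_unique)
  with real assms show ?thesis
    by (auto simp: enn_powr_ennreal intro!: powr_mono2)
qed simp

text \<open>The case 0 * top is included, both sides being 0, so weights can be pulled out of powers
  of possibly infinite integrals.\<close>

lemma enn_powr_mult:
  assumes "0 \<le> a" shows "enn_powr (x * y) a = enn_powr x a * enn_powr y a"
proof (cases x; cases y)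
  fix b c assume "x = ennreal b" "0 \<le> b" "y = ennreal c" "0 \<le> c"
  then show ?thesis
    by (simp add: enn_powr_ennreal powr_mult flip: ennreal_mult)
qed (auto simp: ennreal_mult_top ennreal_top_mult enn_powr_ennreal)

lemma measurable_enn_powr [measurable (raw)]:
  assumes [measurable]: "f \<in> borel_measurable M"
  shows "(\<lambda>x. enn_powr (f x) a) \<in> borel_measurable M"
  unfolding enn_powr_def by measurable

lemma conjugate_gt_1:
  fixes p q :: real
  assumes "1 < p" "1 / p + 1 / q = 1"
  shows "q > 1"
proof -
  have "0 < 1 / p" "1 / p < 1" using assms(1) by auto
  then have "0 < 1 / q" "1 / q < 1" using assms(2) by linarith+
  then show ?thesis by (simp add: divide_less_eq split: if_splits)
qed

text \<open>For finite arguments this is the real inequality; if one argument is infinite, so is the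
  right side, its coefficients being positive.\<close>

lemma Young_enn_powr:
  assumes "1 < p" "1 / p + 1 / q = 1"
  shows "x * y \<le> ennreal (1 / p) * enn_powr x p + ennreal (1 / q) * enn_powr y q"
proof -
  have q: "q > 1"
    by (rule conjugate_gt_1[OF assms])
  show ?thesis
  proof (cases x; cases y)
    fix a b assume ab: "x = ennreal a" "0 \<le> a" "y = ennreal b" "0 \<le> b"
    have "a * b \<le> 1 / p * a powr p + 1 / q * b powr q"
      using Youngs_inequality[of p q a b] assms q ab by simp
    then show ?thesis
      using ab assms q by (simp add: enn_powr_ennreal ennreal_leI flip: ennreal_mult ennreal_plus)
  qed (use assms q in \<open>auto simp: ennreal_mult_top\<close>)
qed

lemma nn_integral_Holder:
  assumes pq: "1 < p" "1 / p + 1 / q = 1"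
    and [measurable]: "u \<in> borel_measurable M" "v \<in> borel_measurable M"
  shows "(\<integral>\<^sup>+x. u x * v x \<partial>M) \<le>
    enn_powr (\<integral>\<^sup>+x. enn_powr (u x) p \<partial>M) (1 / p) * enn_powr (\<integral>\<^sup>+x. enn_powr (v x) q \<partial>M) (1 / q)"
proof -
  define A where "A = (\<integral>\<^sup>+x. enn_powr (u x) p \<partial>M)"
  define B where "B = (\<integral>\<^sup>+x. enn_powr (v x) q \<partial>M)"
  have q: "q > 1"
    by (rule conjugate_gt_1[OF pq])
  have "(\<integral>\<^sup>+x. u x * v x \<partial>M) \<le> enn_powr A (1 / p) * enn_powr B (1 / q)"
  proof (cases "A = 0 \<or> B = 0")
    \<comment> \<open>Since 0 * top = 0 in \<open>ennreal\<close>, a vanishing factor on the right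
      must force the left side to vanish even when the other factor is infinite. This case therefore
      precedes the infinite one.\<close>
    case True
    then have "(AE x in M. u x = 0) \<or> (AE x in M. v x = 0)"
      unfolding A_def B_def by (simp add: nn_integral_0_iff_AE)
    then have "AE x in M. u x * v x = 0"
      by (auto elim: eventually_mono)
    then have "(\<integral>\<^sup>+x. u x * v x \<partial>M) = 0"
      by (subst nn_integral_0_iff_AE) auto
    then show ?thesis by simp
  next
    case False
    show ?thesis
    proof (cases "A = top \<or> B = top")
      case True
      with False show ?thesis by (auto simp: ennreal_mult_eq_top_iff)
    next
      case fin: False
      with False obtain a b where ab: "A = ennreal a" "a > 0" "B = ennreal b" "b > 0"
        by (cases A; cases B) auto
      \<comment> \<open>\<open>a'\<close> and \<open>b'\<close> scale \<open>u\<close> and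
        \<open>v\<close> to unit norm and \<open>c\<close> undoes the scaling. As 1/p + 1/q = 1, the
        integrated Young bound is then exactly \<open>c\<close>.\<close>
      define a' where "a' = ennreal (a powr (-1 / p))"
      define b' where "b' = ennreal (b powr (-1 / q))"
      define c where "c = ennreal (a powr (1 / p) * b powr (1 / q))"
      have c: "c * (a' * b') = 1"
        using ab by (simp add: c_def a'_def b'_def powr_minus field_simps flip: ennreal_mult)
      have a': "enn_powr a' p * A = 1"
        using ab pq powr_powr[of a "-1 / p" p]
        by (simp add: a'_def enn_powr_ennreal powr_neg_one flip: ennreal_mult del: powr_powr)
      have b': "enn_powr b' q * B = 1"
        using ab q powr_powr[of b "-1 / q" q]
        by (simp add: b'_def enn_powr_ennreal powr_neg_one flip: ennreal_mult del: powr_powr)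
      have "(\<integral>\<^sup>+x. u x * v x \<partial>M) = (\<integral>\<^sup>+x. c * ((a' * u x) * (b' * v x)) \<partial>M)"
      proof (rule nn_integral_cong)
        fix x show "u x * v x = c * ((a' * u x) * (b' * v x))"
          using c by (metis (no_types, opaque_lifting) mult.assoc mult.commute mult_1)
      qed
      also have "\<dots> \<le> (\<integral>\<^sup>+x. c * (ennreal (1 / p) * enn_powr (a' * u x) p
            + ennreal (1 / q) * enn_powr (b' * v x) q) \<partial>M)"
        by (intro nn_integral_mono mult_left_mono Young_enn_powr pq) auto
      also have "\<dots> = c * (ennreal (1 / p) * (enn_powr a' p * A) + ennreal (1 / q) * (enn_powr b' q * B))"
        using pq q by (simp add: A_def B_def nn_integral_cmult nn_integral_add enn_powr_mult)
      also have "\<dots> = c"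
        using pq q by (simp add: a' b' flip: ennreal_plus)
      also have "c = enn_powr A (1 / p) * enn_powr B (1 / q)"
        using ab by (simp add: c_def enn_powr_ennreal ennreal_mult)
      finally show ?thesis .
    qed
  qed
  then show ?thesis by (simp add: A_def B_def)
qed

section \<open>Multiplicative convolution on the half-line\<close>

text \<open>Change of variables t = r/s, carried out on compact intervals inside the open half-line
  and extended by monotone convergence.\<close>

lemma nn_integral_inversion:
  fixes g :: "real \<Rightarrow> ennreal"
  assumes [measurable]: "g \<in> borel_measurable borel" and r: "r > 0"
  shows "(\<integral>\<^sup>+t\<in>{0<..}. g t \<partial>lborel) = (\<integral>\<^sup>+s\<in>{0<..}. g (r / s) * ennreal (r / s\<^sup>2) \<partial>lborel)"
proof -
  \<comment> \<open>Starting at 2 keeps each interval from \<open>1 / k n\<close> to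
    \<open>k n\<close> nondegenerate.\<close>
  define k where "k n = real (Suc (Suc n))" for n
  have k: "k n > 1" for n by (simp add: k_def)
  have eq: "(\<integral>\<^sup>+t. g t * indicator {r / k n..r * k n} t \<partial>lborel)
      = (\<integral>\<^sup>+s. g (r / s) * ennreal (r / s\<^sup>2) * indicator {1 / k n..k n} s \<partial>lborel)" for n
  proof -
    \<comment> \<open>The map r/s is decreasing, while the substitution rule asks for a nonnegative
      derivative; after reflecting t the change of variable -(r/s) is increasing.\<close>
    have "(\<integral>\<^sup>+t. g t * indicator {r / k n..r * k n} t \<partial>lborel)
        = (\<integral>\<^sup>+t. g (- t) * indicator {- (r / (1 / k n))..- (r / k n)} t \<partial>lborel)"
      by (subst nn_integral_real_affine[where c="-1" and t=0])
        (auto intro!: nn_integral_cong simp: indicator_def)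
    also have "\<dots> = (\<integral>\<^sup>+s. g (- (- (r / s))) * ennreal (r / s\<^sup>2) * indicator {1 / k n..k n} s \<partial>lborel)"
    proof (rule nn_integral_substitution_aux)
      fix x assume "x \<in> {1 / k n..k n}"
      moreover have "1 / k n > 0" using k[of n] by simp
      ultimately have "x > 0" by (metis atLeastAtMost_iff less_le_trans)
      then show "((\<lambda>x. - (r / x)) has_real_derivative r / x\<^sup>2) (at x)"
        by (auto intro!: derivative_eq_intros simp: power2_eq_square)
      show "0 \<le> r / x\<^sup>2" using r by simp
    next
      show "1 / k n < k n" 
        using k[of n] by (simp add: divide_less_eq less_1_mult)
      show "continuous_on {1 / k n..k n} (\<lambda>x. r / x\<^sup>2)"
      proof (intro continuous_intros ballI)
        fix x assume "x \<in> {1 / k n..k n}"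
        moreover have "1 / k n > 0" using k[of n] by simp
        ultimately have "x > 0" by (metis atLeastAtMost_iff less_le_trans)
        then show "x\<^sup>2 \<noteq> 0" by simp
      qed
    qed auto
    finally show ?thesis by simp
  qed
  \<comment> \<open>These intervals exhaust the half-line. The choice \<open>c = r\<close> serves
    the t side, \<open>c = 1\<close> the s side.\<close>
  have lim: "(\<integral>\<^sup>+t. h t * indicator {0<..} t \<partial>lborel)
      = (SUP n. \<integral>\<^sup>+t. h t * indicator {c / k n..c * k n} t \<partial>lborel)"
    if [measurable]: "h \<in> borel_measurable borel" and c: "c > 0" for h :: "real \<Rightarrow> ennreal" and c
  proof -
    have mono: "c / k m \<ge> c / k n" "c * k m \<le> c * k n" if "m \<le> n" for m n
      using that c k[of m] k[of n] by (auto simp: k_def intro!: divide_left_mono)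
    have "(SUP n. h t * indicator {c / k n..c * k n} t) = h t * indicator {0<..} t" for t
    proof (cases "t > 0")
      case True
      obtain n where n: "real n > max (c / t) (t / c)"
        using reals_Archimedean2 by blast
      then have "k n > c / t" "k n > t / c" by (auto simp: k_def)
      then have "t \<in> {c / k n..c * k n}"
        using True c k[of n] by (auto simp: field_simps)
      then show ?thesis
        using True by (intro antisym SUP_least SUP_upper2[of n]) (auto simp: indicator_def)
    next
      case False
      moreover have "c / k n > 0" for n using c k[of n] by simp
      ultimately have "t \<notin> {c / k n..c * k n}" for n
        by (meson atLeastAtMost_iff less_le_trans)
      with False show ?thesis by simp
    qed
    then have "(\<integral>\<^sup>+t. h t * indicator {0<..} t \<partial>lborel)
      = (\<integral>\<^sup>+t. (SUP n. h t * indicator {c / k n..c * k n} t) \<partial>lborel)"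
      by simp
    also have "\<dots> = (SUP n. \<integral>\<^sup>+t. h t * indicator {c / k n..c * k n} t \<partial>lborel)"
      using mono by (intro nn_integral_monotone_convergence_SUP)
        (fastforce simp: incseq_def le_fun_def intro!: mult_left_mono indicator_leI intro: order_trans)+
    finally show ?thesis .
  qed
  show ?thesis
    using lim[of g r] lim[of "\<lambda>s. g (r / s) * ennreal (r / s\<^sup>2)" 1] r by (simp add: eq)
qed

text \<open>The density r/s^2 is positive, so preimages of null sets under s \<mapsto> r/s are null.
  It holds for each single \<open>r\<close>, which is why no radius has to be excluded
  later.\<close>

lemma AE_inversion:
  assumes P: "AE t in lborel. P t" and r: "r > (0::real)"
  shows "AE s in lborel. s > 0 \<longrightarrow> P (r / s)"
proof -
  from P obtain N where N: "{t. \<not> P t} \<subseteq> N" "emeasure lborel N = 0" "N \<in> sets lborel"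
    by (auto elim: AE_E)
  then have [measurable]: "N \<in> sets borel" by simp
  have "(\<integral>\<^sup>+s\<in>{0<..}. indicator N (r / s) * ennreal (r / s\<^sup>2) \<partial>lborel)
      = (\<integral>\<^sup>+t\<in>{0<..}. indicator N t \<partial>lborel)"
    using r by (intro nn_integral_inversion[symmetric]) auto
  also have "\<dots> \<le> (\<integral>\<^sup>+t. indicator N t \<partial>lborel)"
    by (intro nn_integral_mono) (auto simp: indicator_def)
  also have "\<dots> = 0"
    using N by simp
  finally have "AE s in lborel. indicator N (r / s) * ennreal (r / s\<^sup>2) * indicator {0<..} s = 0"
    by (subst (asm) le_zero_eq, subst (asm) nn_integral_0_iff_AE) auto
  then show ?thesis
    by eventually_elim (use r N in \<open>auto simp: indicator_def split: if_splits\<close>)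
qed

text \<open>Here \<open>\<phi>\<close> stands for the kernel on one ray and \<open>F\<close> for the
  spherical means of |f|. Hoelder is applied after splitting s^(\<beta>-1) into s^(\<delta>/p),
  which gives \<open>F\<close> its weight, and the remaining power, which goes to the kernel. The
  choice of \<open>c\<close> makes that power become the kernel weight t^(cq-1) under t = r/s,
  leaving only r^(-c) in front.\<close>

lemma radial_convolution_bound:
  fixes \<phi> :: "real \<Rightarrow> real" and F :: "real \<Rightarrow> ennreal"
  assumes [measurable]: "\<phi> \<in> borel_measurable borel" "F \<in> borel_measurable borel"
    and \<phi>: "\<And>t. 0 \<le> \<phi> t" and r: "r > 0"
    and pq: "1 < p" "1 / p + 1 / q = 1"
    and c: "c = (\<delta> + 1) / p - \<beta>"
  shows "(\<integral>\<^sup>+s\<in>{0<..}. F s * ennreal (\<phi> (r / s) * s powr (\<beta> - 1)) \<partial>lborel)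
    \<le> ennreal (r powr (- c))
      * enn_powr (\<integral>\<^sup>+t\<in>{0<..}. ennreal (\<phi> t powr q * t powr (c * q - 1)) \<partial>lborel) (1 / q)
      * enn_powr (\<integral>\<^sup>+s\<in>{0<..}. enn_powr (F s) p * ennreal (s powr \<delta>) \<partial>lborel) (1 / p)"
proof -
  have q: "q > 1" by (rule conjugate_gt_1[OF pq])
  define u where "u s = F s * ennreal (s powr (\<delta> / p)) * indicator {0<..} s" for s
  define v where "v s = ennreal (\<phi> (r / s) * s powr (\<beta> - 1 - \<delta> / p)) * indicator {0<..} s" for s
  define G where "G t = ennreal (\<phi> t powr q * t powr (c * q - 1))" for t
  have [measurable]: "u \<in> borel_measurable borel" "v \<in> borel_measurable borel" "G \<in> borel_measurable borel"
    unfolding u_def v_def G_def by measurable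
  \<comment> \<open>By the choice of \<open>c\<close> and 1/p + 1/q = 1, the leftover exponent
    \<beta> - 1 - \<delta>/p equals -c - 1/q.\<close>
  have e: "(\<beta> - 1 - \<delta> / p) * q = - c * q - 1"
  proof -
    have "\<beta> - 1 - \<delta> / p = - c - 1 / q"
      using pq by (simp add: c add_divide_distrib)
    then show ?thesis using q by (simp add: field_simps)
  qed
  have "(\<integral>\<^sup>+s\<in>{0<..}. F s * ennreal (\<phi> (r / s) * s powr (\<beta> - 1)) \<partial>lborel) = (\<integral>\<^sup>+s. u s * v s \<partial>lborel)"
  proof (rule nn_integral_cong)
    fix s :: real
    have "\<phi> (r / s) * s powr (\<beta> - 1) = s powr (\<delta> / p) * (\<phi> (r / s) * s powr (\<beta> - 1 - \<delta> / p))"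
      by (simp flip: powr_add)
    then have "ennreal (\<phi> (r / s) * s powr (\<beta> - 1))
        = ennreal (s powr (\<delta> / p)) * ennreal (\<phi> (r / s) * s powr (\<beta> - 1 - \<delta> / p))"
      using \<phi> by (simp only: ennreal_mult powr_ge_zero mult_nonneg_nonneg)
    then show "F s * ennreal (\<phi> (r / s) * s powr (\<beta> - 1)) * indicator {0<..} s = u s * v s"
      by (simp only: u_def v_def) (simp add: indicator_def mult.assoc)
  qed
  also have "\<dots> \<le> enn_powr (\<integral>\<^sup>+s. enn_powr (u s) p \<partial>lborel) (1 / p)
      * enn_powr (\<integral>\<^sup>+s. enn_powr (v s) q \<partial>lborel) (1 / q)"
    by (intro nn_integral_Holder pq) auto
  also have "(\<integral>\<^sup>+s. enn_powr (u s) p \<partial>lborel)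
      = (\<integral>\<^sup>+s\<in>{0<..}. enn_powr (F s) p * ennreal (s powr \<delta>) \<partial>lborel)"
    using pq by (intro nn_integral_cong)
      (auto simp: u_def indicator_def enn_powr_mult enn_powr_ennreal powr_powr)
  also have "(\<integral>\<^sup>+s. enn_powr (v s) q \<partial>lborel)
      = (\<integral>\<^sup>+s. ennreal (r powr (- c * q)) * (G (r / s) * ennreal (r / s\<^sup>2) * indicator {0<..} s) \<partial>lborel)"
  proof (rule nn_integral_cong)
    fix s :: real
    show "enn_powr (v s) q = ennreal (r powr (- c * q)) * (G (r / s) * ennreal (r / s\<^sup>2) * indicator {0<..} s)"
    proof (cases "s > 0")
      case True
      have "(r / s) powr (c * q - 1) * (r / s\<^sup>2) = r powr (c * q) * s powr (- c * q - 1)"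
      proof -
        have "(r / s) powr (c * q - 1) * (r / s\<^sup>2)
            = (r powr (c * q) / r) / (s powr (c * q) / s) * (r / s\<^sup>2)"
          using True r by (simp add: powr_divide powr_diff)
        also have "\<dots> = r powr (c * q) / (s powr (c * q) * s)"
          using True r by (simp add: field_simps power2_eq_square)
        also have "\<dots> = r powr (c * q) * s powr (- c * q - 1)"
          using True by (simp add: powr_diff powr_minus divide_simps)
        finally show ?thesis .
      qed
      then have "r powr (- c * q) * (\<phi> (r / s) powr q * ((r / s) powr (c * q - 1) * (r / s\<^sup>2)))
          = \<phi> (r / s) powr q * s powr (- c * q - 1)"
        using r by (simp add: powr_minus)
      then have "ennreal (r powr (- c * q)) * (G (r / s) * ennreal (r / s\<^sup>2))
          = ennreal (\<phi> (r / s) powr q * s powr (- c * q - 1))"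
        unfolding G_def using r by (simp add: mult.assoc flip: ennreal_mult)
      also have "\<dots> = enn_powr (v s) q"
        using True \<phi> by (simp add: v_def enn_powr_ennreal powr_mult powr_powr e)
      finally show ?thesis using True by simp
    qed (simp add: v_def)
  qed
  also have "\<dots> = ennreal (r powr (- c * q)) * (\<integral>\<^sup>+s. G (r / s) * ennreal (r / s\<^sup>2) * indicator {0<..} s \<partial>lborel)"
    by (rule nn_integral_cmult) auto
  also have "(\<integral>\<^sup>+s. G (r / s) * ennreal (r / s\<^sup>2) * indicator {0<..} s \<partial>lborel) = (\<integral>\<^sup>+t\<in>{0<..}. G t \<partial>lborel)"
    using r by (intro nn_integral_inversion[symmetric]) auto
  also have "enn_powr (ennreal (r powr (- c * q)) * (\<integral>\<^sup>+t\<in>{0<..}. G t \<partial>lborel)) (1 / q)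
      = ennreal (r powr (- c)) * enn_powr (\<integral>\<^sup>+t\<in>{0<..}. G t \<partial>lborel) (1 / q)"
    using q by (simp add: enn_powr_mult enn_powr_ennreal powr_powr)
  finally show ?thesis
    by (simp add: G_def mult_ac)
qed

text \<open>Endpoint version: the weighted supremum of the kernel is pulled out of the integral.
  \<open>K\<close> is any almost-everywhere bound, so the radial norm of \<open>\<Phi>\<close> can
  be used while \<open>\<phi>\<close> comes from its Borel representative.\<close>

lemma radial_convolution_bound_1:
  fixes \<phi> :: "real \<Rightarrow> real" and F :: "real \<Rightarrow> ennreal"
  assumes [measurable]: "F \<in> borel_measurable borel"
    and \<phi>: "\<And>t. 0 \<le> \<phi> t" and r: "r > 0" and c: "c = \<delta> + 1 - \<beta>"
    and K: "AE t in lborel. t > 0 \<longrightarrow> ennreal (\<phi> t * t powr c) \<le> K"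
  shows "(\<integral>\<^sup>+s\<in>{0<..}. F s * ennreal (\<phi> (r / s) * s powr (\<beta> - 1)) \<partial>lborel)
    \<le> ennreal (r powr (- c)) * K * (\<integral>\<^sup>+s\<in>{0<..}. F s * ennreal (s powr \<delta>) \<partial>lborel)"
proof -
  have "(\<integral>\<^sup>+s\<in>{0<..}. F s * ennreal (\<phi> (r / s) * s powr (\<beta> - 1)) \<partial>lborel)
    \<le> (\<integral>\<^sup>+s. ennreal (r powr (- c)) * K * (F s * ennreal (s powr \<delta>) * indicator {0<..} s) \<partial>lborel)"
  proof (rule nn_integral_mono_AE)
    show "AE s in lborel. F s * ennreal (\<phi> (r / s) * s powr (\<beta> - 1)) * indicator {0<..} s
        \<le> ennreal (r powr (- c)) * K * (F s * ennreal (s powr \<delta>) * indicator {0<..} s)"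
      using AE_inversion[OF K r]
    proof eventually_elim
      case (elim s)
      show ?case
      proof (cases "s > 0")
        case True
        \<comment> \<open>The powers of r cancel, and those of s combine to \<delta> - c = \<beta> -
          1.\<close>
        have "\<phi> (r / s) * s powr (\<beta> - 1) = r powr (- c) * (\<phi> (r / s) * (r / s) powr c) * s powr \<delta>"
          using True r by (simp add: powr_divide powr_minus c powr_diff powr_add field_simps)
        then have "ennreal (\<phi> (r / s) * s powr (\<beta> - 1))
            = ennreal (r powr (- c)) * ennreal (\<phi> (r / s) * (r / s) powr c) * ennreal (s powr \<delta>)"
          using \<phi> by (simp only: ennreal_mult powr_ge_zero mult_nonneg_nonneg)
        also have "\<dots> \<le> ennreal (r powr (- c)) * K * ennreal (s powr \<delta>)"
          using elim True r by (intro mult_left_mono mult_right_mono) auto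
        finally have "F s * ennreal (\<phi> (r / s) * s powr (\<beta> - 1))
            \<le> F s * (ennreal (r powr (- c)) * K * ennreal (s powr \<delta>))"
          by (rule mult_left_mono) simp
        then show ?thesis
          using True by (simp add: mult_ac)
      qed simp
    qed
  qed
  also have "\<dots> = ennreal (r powr (- c)) * K * (\<integral>\<^sup>+s\<in>{0<..}. F s * ennreal (s powr \<delta>) \<partial>lborel)"
    by (rule nn_integral_cmult) auto
  finally show ?thesis .
qed

section \<open>The Hausdorff operator on rays\<close>

lemma lebesgue_measurable_ex_borel_complex:
  fixes g :: "'a::euclidean_space \<Rightarrow> complex"
  assumes "g \<in> borel_measurable lebesgue"
  obtains g' where "g' \<in> borel_measurable borel" "AE x in lborel. g x = g' x"
proof -
  have "(\<lambda>x. Re (g x)) \<in> borel_measurable lebesgue" "(\<lambda>x. Im (g x)) \<in> borel_measurable lebesgue"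
    using assms by measurable
  then obtain a b where ab: "a \<in> borel_measurable lborel" "AE x in lborel. Re (g x) = a x"
      "b \<in> borel_measurable lborel" "AE x in lborel. Im (g x) = b x"
    by (metis completion_ex_borel_measurable_real)
  have "(\<lambda>x. Complex (a x) (b x)) \<in> borel_measurable borel"
    using ab unfolding Complex_eq by simp
  moreover from ab(2,4) have "AE x in lborel. g x = Complex (a x) (b x)"
    by eventually_elim (simp add: complex_eq_iff)
  ultimately show ?thesis by (rule that)
qed

lemma measurable_hausdorff_integrand:
  fixes \<Phi> f :: "'a::euclidean_space \<Rightarrow> complex"
  assumes [measurable]: "\<Phi> \<in> borel_measurable borel" "f \<in> borel_measurable borel"
  shows "(\<lambda>(x, y). hausdorff_integrand \<Phi> \<beta> f x y) \<in> borel_measurable (borel \<Otimes>\<^sub>M borel)"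
    and "hausdorff_integrand \<Phi> \<beta> f x \<in> borel_measurable borel"
  unfolding hausdorff_integrand_def by measurable

text \<open>The quantifier order is the point: the null set of directions does not depend on
  \<open>r\<close>. For a good direction, the bad values t on the ray form a null set; inversion
  turns it into a null set of values |y|, and the corresponding spheres into a null set of
  \<open>y\<close>.\<close>

lemma hausdorff_integrand_cong_AE:
  fixes \<Phi> \<Phi>' f f' :: "'a::euclidean_space \<Rightarrow> complex"
  assumes \<Phi>: "AE x in lborel. \<Phi> x = \<Phi>' x" and f: "AE x in lborel. f x = f' x"
  shows "AE \<theta> in sphere_measure. \<forall>r>0. AE y in lborel.
    hausdorff_integrand \<Phi> \<beta> f (r *\<^sub>R \<theta>) y = hausdorff_integrand \<Phi>' \<beta> f' (r *\<^sub>R \<theta>) y"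
  using AE_polar(2)[OF \<Phi>]
proof eventually_elim
  case (elim \<theta>)
  show ?case
  proof (intro allI impI)
    fix r :: real assume r: "r > 0"
    have "AE s in lborel. s > 0 \<longrightarrow> \<Phi> ((r / s) *\<^sub>R \<theta>) = \<Phi>' ((r / s) *\<^sub>R \<theta>)"
      using AE_inversion[OF elim r] by eventually_elim (use r in auto)
    from AE_lborel_normI[OF this] f AE_lborel_singleton[of 0]
    show "AE y in lborel. hausdorff_integrand \<Phi> \<beta> f (r *\<^sub>R \<theta>) y = hausdorff_integrand \<Phi>' \<beta> f' (r *\<^sub>R \<theta>) y"
      by eventually_elim (simp add: hausdorff_integrand_def divide_inverse mult.commute)
  qed
qed

text \<open>On the sphere |y| = s the kernel factor is constant and leaves the angular integral; its
  power s^(\<beta>-n) and the Jacobian s^(n-1), with n the dimension, combine to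
  s^(\<beta>-1).\<close>

lemma nn_integral_norm_hausdorff_integrand:
  fixes \<Phi> f :: "'a::euclidean_space \<Rightarrow> complex"
  assumes [measurable]: "\<Phi> \<in> borel_measurable borel" "f \<in> borel_measurable borel"
    and r: "r > 0"
  shows "(\<integral>\<^sup>+y. ennreal (norm (hausdorff_integrand \<Phi> \<beta> f (r *\<^sub>R \<theta>) y)) \<partial>lborel)
    = (\<integral>\<^sup>+s\<in>{0<..}. (\<integral>\<^sup>+\<eta>. ennreal (norm (f (s *\<^sub>R \<eta>))) \<partial>sphere_measure)
        * ennreal (norm (\<Phi> ((r / s) *\<^sub>R \<theta>)) * s powr (\<beta> - 1)) \<partial>lborel)"
proof -
  note measurable_hausdorff_integrand(2)[measurable]
  have "(\<integral>\<^sup>+y. ennreal (norm (hausdorff_integrand \<Phi> \<beta> f (r *\<^sub>R \<theta>) y)) \<partial>lborel)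
    = (\<integral>\<^sup>+s\<in>{0<..}. (\<integral>\<^sup>+\<eta>. ennreal (norm (hausdorff_integrand \<Phi> \<beta> f (r *\<^sub>R \<theta>) (s *\<^sub>R \<eta>))) \<partial>sphere_measure)
        * ennreal (s ^ (DIM('a) - 1)) \<partial>lborel)"
    by (rule nn_integral_polar) measurable
  also have "\<dots> = (\<integral>\<^sup>+s\<in>{0<..}. (\<integral>\<^sup>+\<eta>. ennreal (norm (f (s *\<^sub>R \<eta>))) \<partial>sphere_measure)
        * ennreal (norm (\<Phi> ((r / s) *\<^sub>R \<theta>)) * s powr (\<beta> - 1)) \<partial>lborel)"
  proof (rule nn_integral_cong)
    fix s :: real
    show "(\<integral>\<^sup>+\<eta>. ennreal (norm (hausdorff_integrand \<Phi> \<beta> f (r *\<^sub>R \<theta>) (s *\<^sub>R \<eta>))) \<partial>sphere_measure)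
        * ennreal (s ^ (DIM('a) - 1)) * indicator {0<..} s
      = (\<integral>\<^sup>+\<eta>. ennreal (norm (f (s *\<^sub>R \<eta>))) \<partial>sphere_measure)
        * ennreal (norm (\<Phi> ((r / s) *\<^sub>R \<theta>)) * s powr (\<beta> - 1)) * indicator {0<..} s"
    proof (cases "s > 0")
      case True
      define a where "a = norm (\<Phi> ((r / s) *\<^sub>R \<theta>)) / s powr (real DIM('a) - \<beta>)"
      have "(\<integral>\<^sup>+\<eta>. ennreal (norm (hausdorff_integrand \<Phi> \<beta> f (r *\<^sub>R \<theta>) (s *\<^sub>R \<eta>))) \<partial>sphere_measure)
          = (\<integral>\<^sup>+\<eta>. ennreal a * ennreal (norm (f (s *\<^sub>R \<eta>))) \<partial>sphere_measure)"
      proof (rule nn_integral_cong)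
        fix \<eta> :: 'a assume "\<eta> \<in> space sphere_measure"
        then have \<eta>: "norm (s *\<^sub>R \<eta>) = s" using True by simp
        have arg: "(r *\<^sub>R \<theta>) /\<^sub>R s = (r / s) *\<^sub>R \<theta>" by (simp add: divide_inverse mult.commute)
        have "norm (hausdorff_integrand \<Phi> \<beta> f (r *\<^sub>R \<theta>) (s *\<^sub>R \<eta>)) = a * norm (f (s *\<^sub>R \<eta>))"
          unfolding hausdorff_integrand_def \<eta> arg a_def norm_mult norm_divide norm_of_real by simp
        then show "ennreal (norm (hausdorff_integrand \<Phi> \<beta> f (r *\<^sub>R \<theta>) (s *\<^sub>R \<eta>)))
            = ennreal a * ennreal (norm (f (s *\<^sub>R \<eta>)))"
          by (simp only: ennreal_mult norm_ge_zero a_def divide_nonneg_nonneg powr_ge_zero)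
      qed
      also have "\<dots> = ennreal a * (\<integral>\<^sup>+\<eta>. ennreal (norm (f (s *\<^sub>R \<eta>))) \<partial>sphere_measure)"
        by (rule nn_integral_cmult) measurable
      finally have 1: "(\<integral>\<^sup>+\<eta>. ennreal (norm (hausdorff_integrand \<Phi> \<beta> f (r *\<^sub>R \<theta>) (s *\<^sub>R \<eta>))) \<partial>sphere_measure)
          = ennreal a * (\<integral>\<^sup>+\<eta>. ennreal (norm (f (s *\<^sub>R \<eta>))) \<partial>sphere_measure)" .
      have "s ^ (DIM('a) - 1) = s powr (real DIM('a) - 1)"
        using True by (simp add: powr_realpow[symmetric] of_nat_diff Suc_leI)
      then have 2: "a * s ^ (DIM('a) - 1) = norm (\<Phi> ((r / s) *\<^sub>R \<theta>)) * s powr (\<beta> - 1)"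
        using True by (simp add: a_def powr_diff field_simps)
      have "ennreal a * ennreal (s ^ (DIM('a) - 1)) = ennreal (norm (\<Phi> ((r / s) *\<^sub>R \<theta>)) * s powr (\<beta> - 1))"
        unfolding 2[symmetric] using True by (intro ennreal_mult[symmetric]) (auto simp: a_def)
      then have "ennreal a * F * ennreal (s ^ (DIM('a) - 1)) = F * ennreal (norm (\<Phi> ((r / s) *\<^sub>R \<theta>)) * s powr (\<beta> - 1))" for F
        by (metis mult.assoc mult.commute)
      then show ?thesis
        unfolding 1 by simp
    qed simp
  qed
  finally show ?thesis .
qed

text \<open>For almost every radius the two functions agree almost everywhere on the sphere, so the
  norm may be computed from a Borel representative. Completing a measure does not change nonnegative
  integrals, which allows the uncompleted measures on the right.\<close>

lemma mixed_norm_1_eq: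
  fixes f f' :: "'a::euclidean_space \<Rightarrow> complex"
  assumes "AE x in lborel. f x = f' x"
  shows "mixed_norm p 1 (\<lambda>r. r powr \<alpha>) f
    = enn_powr (\<integral>\<^sup>+s\<in>{0<..}. enn_powr (\<integral>\<^sup>+\<eta>. ennreal (norm (f' (s *\<^sub>R \<eta>))) \<partial>sphere_measure) p
        * ennreal (s powr (\<alpha> + real DIM('a) - 1)) \<partial>lborel) (1 / p)"
proof -
  have "(\<integral>\<^sup>+r\<in>{0<..}. enn_powr (\<integral>\<^sup>+\<theta>. ennreal (norm (f (r *\<^sub>R \<theta>)) powr 1) \<partial>sphere_measure) (p / 1)
          * ennreal (r ^ (DIM('a) - 1) * r powr \<alpha>) \<partial>lborel)
    = (\<integral>\<^sup>+s\<in>{0<..}. enn_powr (\<integral>\<^sup>+\<eta>. ennreal (norm (f' (s *\<^sub>R \<eta>))) \<partial>sphere_measure) p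
        * ennreal (s powr (\<alpha> + real DIM('a) - 1)) \<partial>lborel)"
  proof (rule nn_integral_cong_AE)
    show "AE r in lborel. enn_powr (\<integral>\<^sup>+\<theta>. ennreal (norm (f (r *\<^sub>R \<theta>)) powr 1) \<partial>sphere_measure) (p / 1)
          * ennreal (r ^ (DIM('a) - 1) * r powr \<alpha>) * indicator {0<..} r
      = enn_powr (\<integral>\<^sup>+\<eta>. ennreal (norm (f' (r *\<^sub>R \<eta>))) \<partial>sphere_measure) p
        * ennreal (r powr (\<alpha> + real DIM('a) - 1)) * indicator {0<..} r"
      using AE_polar(1)[OF assms]
    proof eventually_elim
      case (elim r)
      show ?case
      proof (cases "r > 0")
        case True
        with elim have "AE \<theta> in sphere_measure. f (r *\<^sub>R \<theta>) = f' (r *\<^sub>R \<theta>)" by simp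
        then have "(\<integral>\<^sup>+\<theta>. ennreal (norm (f (r *\<^sub>R \<theta>)) powr 1) \<partial>sphere_measure)
            = (\<integral>\<^sup>+\<theta>. ennreal (norm (f' (r *\<^sub>R \<theta>))) \<partial>sphere_measure)"
          by (intro nn_integral_cong_AE) (auto elim: eventually_mono)
        moreover have "r ^ (DIM('a) - 1) * r powr \<alpha> = r powr (\<alpha> + real DIM('a) - 1)"
          using True by (simp add: powr_realpow[symmetric] of_nat_diff Suc_leI algebra_simps flip: powr_add)
        ultimately show ?thesis by simp
      qed simp
    qed
  qed
  then show ?thesis
    by (simp only: mixed_norm_def surface_measure_eq nn_integral_completion)
qed

text \<open>Bounding the absolute integral instead of the operator yields integrability and the
  pointwise estimate together. A direction is good if its radial norm is at most
  \<open>kernel_norm\<close>, if \<open>\<Phi>\<close> agrees with its representative almost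
  everywhere on its ray, and if the integrands agree for all radii.\<close>

lemma hausdorff_integrand_ray_bound:
  fixes \<Phi> f :: "'a::euclidean_space \<Rightarrow> complex"
  assumes p1: "1 \<le> p1"
    and scaling: "(\<gamma> + real DIM('a)) / p2 = (\<alpha> + real DIM('a)) / p1 - \<beta>"
    and \<Phi>: "\<Phi> \<in> borel_measurable lebesgue" and f: "f \<in> borel_measurable lebesgue"
  shows "AE \<theta> in sphere_measure. \<forall>r>0. hausdorff_integrand \<Phi> \<beta> f (r *\<^sub>R \<theta>) \<in> borel_measurable lebesgue \<and>
    (\<integral>\<^sup>+y. ennreal (norm (hausdorff_integrand \<Phi> \<beta> f (r *\<^sub>R \<theta>) y)) \<partial>lebesgue)
      \<le> ennreal (r powr (- ((\<gamma> + real DIM('a)) / p2)))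
        * (kernel_norm p1 p2 \<gamma> \<Phi> * mixed_norm p1 1 (\<lambda>r. r powr \<alpha>) f)"
proof -
  obtain \<Phi>' where [measurable]: "\<Phi>' \<in> borel_measurable borel" and \<Phi>': "AE x in lborel. \<Phi> x = \<Phi>' x"
    using lebesgue_measurable_ex_borel_complex[OF \<Phi>] by blast
  obtain f' where [measurable]: "f' \<in> borel_measurable borel" and f': "AE x in lborel. f x = f' x"
    using lebesgue_measurable_ex_borel_complex[OF f] by blast
  define c where "c = (\<gamma> + real DIM('a)) / p2"
  \<comment> \<open>The total power of the radius in the norm of \<open>f\<close>, Jacobian
    included; in terms of it the scaling condition is the relation required by the convolution
    bounds.\<close>
  define \<delta> where "\<delta> = \<alpha> + real DIM('a) - 1"
  have c: "c = (\<delta> + 1) / p1 - \<beta>"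
    using scaling by (simp add: c_def \<delta>_def)
  define F where "F s = (\<integral>\<^sup>+\<eta>. ennreal (norm (f' (s *\<^sub>R \<eta>))) \<partial>sphere_measure)" for s
  have [measurable]: "F \<in> borel_measurable borel"
    unfolding F_def by measurable
  have M: "mixed_norm p1 1 (\<lambda>r. r powr \<alpha>) f
      = enn_powr (\<integral>\<^sup>+s\<in>{0<..}. enn_powr (F s) p1 * ennreal (s powr \<delta>) \<partial>lborel) (1 / p1)"
    unfolding F_def \<delta>_def by (rule mixed_norm_1_eq[OF f'])
  \<comment> \<open>The inner radial norm of \<open>kernel_norm\<close>, kept in terms of
    \<open>\<Phi>\<close> itself; passing to the Borel representative happens on one ray at a
    time.\<close>
  define k where "k \<theta> = (if p1 = 1
       then esssup (lebesgue_on {0<..}) (\<lambda>t. ennreal (norm (\<Phi> (t *\<^sub>R \<theta>)) * t powr c))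
       else enn_powr (\<integral>\<^sup>+t\<in>{0<..}. ennreal (norm (\<Phi> (t *\<^sub>R \<theta>)) powr conj_exponent p1
                  * t powr (c * conj_exponent p1 - 1)) \<partial>lebesgue) (1 / conj_exponent p1))" for \<theta>
  have "AE \<theta> in surface_measure. k \<theta> \<le> kernel_norm p1 p2 \<gamma> \<Phi>"
    unfolding kernel_norm_def k_def c_def times_divide_eq_left by (rule esssup_AE)
  then have K: "AE \<theta> in sphere_measure. k \<theta> \<le> kernel_norm p1 p2 \<gamma> \<Phi>"
    unfolding surface_measure_eq AE_completion_iff .
  have bound: "(\<integral>\<^sup>+s\<in>{0<..}. F s * ennreal (norm (\<Phi>' ((r / s) *\<^sub>R \<theta>)) * s powr (\<beta> - 1)) \<partial>lborel)
      \<le> ennreal (r powr (- c)) * k \<theta> * mixed_norm p1 1 (\<lambda>r. r powr \<alpha>) f"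
    if eq: "AE t in lborel. t > 0 \<longrightarrow> \<Phi> (t *\<^sub>R \<theta>) = \<Phi>' (t *\<^sub>R \<theta>)" and r: "r > 0" for r \<theta>
  proof (cases "p1 = 1")
    case True
    have "AE t in lebesgue_on {0<..}. ennreal (norm (\<Phi> (t *\<^sub>R \<theta>)) * t powr c) \<le> k \<theta>"
      using True esssup_AE by (simp add: k_def)
    then have "AE t in lborel. t > 0 \<longrightarrow> ennreal (norm (\<Phi> (t *\<^sub>R \<theta>)) * t powr c) \<le> k \<theta>"
      by (simp add: AE_restrict_space_iff AE_completion_iff)
    with eq have "AE t in lborel. t > 0 \<longrightarrow> ennreal (norm (\<Phi>' (t *\<^sub>R \<theta>)) * t powr c) \<le> k \<theta>"
      by eventually_elim auto
    then have "(\<integral>\<^sup>+s\<in>{0<..}. F s * ennreal (norm (\<Phi>' ((r / s) *\<^sub>R \<theta>)) * s powr (\<beta> - 1)) \<partial>lborel)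
      \<le> ennreal (r powr (- c)) * k \<theta> * (\<integral>\<^sup>+s\<in>{0<..}. F s * ennreal (s powr \<delta>) \<partial>lborel)"
      using r c True by (intro radial_convolution_bound_1[where \<phi>="\<lambda>t. norm (\<Phi>' (t *\<^sub>R \<theta>))"]) auto
    then show ?thesis
      using True M by simp
  next
    case False
    with p1 have p: "1 < p1" by simp
    define q where "q = conj_exponent p1"
    have q: "1 / p1 + 1 / q = 1"
      using p by (simp add: q_def conj_exponent_def field_simps)
    have "(\<integral>\<^sup>+t\<in>{0<..}. ennreal (norm (\<Phi>' (t *\<^sub>R \<theta>)) powr q * t powr (c * q - 1)) \<partial>lborel)
        = (\<integral>\<^sup>+t\<in>{0<..}. ennreal (norm (\<Phi> (t *\<^sub>R \<theta>)) powr q * t powr (c * q - 1)) \<partial>lborel)"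
      using eq by (intro nn_integral_cong_AE, eventually_elim) (auto simp: indicator_def)
    then have "k \<theta> = enn_powr (\<integral>\<^sup>+t\<in>{0<..}. ennreal (norm (\<Phi>' (t *\<^sub>R \<theta>)) powr q * t powr (c * q - 1)) \<partial>lborel) (1 / q)"
      using False by (simp add: k_def nn_integral_completion q_def)
    then show ?thesis
      using radial_convolution_bound[of "\<lambda>t. norm (\<Phi>' (t *\<^sub>R \<theta>))" F r p1 q c \<delta> \<beta>] r p q c
      by (simp add: M)
  qed
  from K AE_polar(2)[OF \<Phi>'] hausdorff_integrand_cong_AE[OF \<Phi>' f', of \<beta>]
  show ?thesis
  proof eventually_elim
    case (elim \<theta>)
    show ?case
    proof (intro allI impI conjI)
      fix r :: real assume r: "r > 0"
      let ?h = "hausdorff_integrand \<Phi> \<beta> f (r *\<^sub>R \<theta>)" and ?h' = "hausdorff_integrand \<Phi>' \<beta> f' (r *\<^sub>R \<theta>)"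
      have eq: "AE y in lborel. ?h y = ?h' y"
        using elim r by simp
      have h': "?h' \<in> borel_measurable borel"
        by (rule measurable_hausdorff_integrand) measurable
      show "?h \<in> borel_measurable lebesgue"
      proof (rule borel_measurable_AE)
        show "?h' \<in> borel_measurable lebesgue"
          using h' by (intro measurable_completion) simp
        show "AE y in lebesgue. ?h' y = ?h y"
          using eq unfolding AE_completion_iff by eventually_elim simp
      qed
      have "(\<integral>\<^sup>+y. ennreal (norm (?h y)) \<partial>lebesgue) = (\<integral>\<^sup>+y. ennreal (norm (?h' y)) \<partial>lborel)"
        unfolding nn_integral_completion
        using eq by (intro nn_integral_cong_AE) (auto elim: eventually_mono)
      also have "\<dots> = (\<integral>\<^sup>+s\<in>{0<..}. F s * ennreal (norm (\<Phi>' ((r / s) *\<^sub>R \<theta>)) * s powr (\<beta> - 1)) \<partial>lborel)"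
        unfolding F_def using r by (intro nn_integral_norm_hausdorff_integrand) auto
      also have "\<dots> \<le> ennreal (r powr (- c)) * k \<theta> * mixed_norm p1 1 (\<lambda>r. r powr \<alpha>) f"
        using elim(2) r by (rule bound)
      also have "\<dots> \<le> ennreal (r powr (- c)) * kernel_norm p1 p2 \<gamma> \<Phi> * mixed_norm p1 1 (\<lambda>r. r powr \<alpha>) f"
        using elim(1) by (intro mult_right_mono mult_left_mono) auto
      finally show "(\<integral>\<^sup>+y. ennreal (norm (?h y)) \<partial>lebesgue) \<le> ennreal (r powr (- ((\<gamma> + real DIM('a)) / p2)))
        * (kernel_norm p1 p2 \<gamma> \<Phi> * mixed_norm p1 1 (\<lambda>r. r powr \<alpha>) f)"
        by (simp add: c_def mult.assoc)
    qed
  qed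
qed

text \<open>For Borel representatives the operator is a parameter integral of a jointly Borel
  function. It agrees with the given one off the cone over a null set of directions, and Lebesgue
  measure is complete.\<close>

lemma borel_measurable_hausdorff_op:
  fixes \<Phi> f :: "'a::euclidean_space \<Rightarrow> complex"
  assumes \<Phi>: "\<Phi> \<in> borel_measurable lebesgue" and f: "f \<in> borel_measurable lebesgue"
  shows "hausdorff_op \<Phi> \<beta> f \<in> borel_measurable lebesgue"
proof -
  obtain \<Phi>' where [measurable]: "\<Phi>' \<in> borel_measurable borel" and \<Phi>': "AE x in lborel. \<Phi> x = \<Phi>' x"
    using lebesgue_measurable_ex_borel_complex[OF \<Phi>] by blast
  obtain f' where [measurable]: "f' \<in> borel_measurable borel" and f': "AE x in lborel. f x = f' x"
    using lebesgue_measurable_ex_borel_complex[OF f] by blast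
  have joint: "(\<lambda>(x, y). hausdorff_integrand \<Phi>' \<beta> f' x y) \<in> borel_measurable (borel \<Otimes>\<^sub>M lborel)"
    using measurable_hausdorff_integrand(1)[of \<Phi>' f'] by simp
  have h': "hausdorff_integrand \<Phi>' \<beta> f' x \<in> borel_measurable borel" for x
    by (rule measurable_hausdorff_integrand) measurable
  have H': "hausdorff_op \<Phi>' \<beta> f' = (\<lambda>x. \<integral>y. hausdorff_integrand \<Phi>' \<beta> f' x y \<partial>lborel)"
    unfolding hausdorff_op_def using h' by (intro ext integral_completion) simp
  have "hausdorff_op \<Phi>' \<beta> f' \<in> borel_measurable borel"
    unfolding H' using lborel.borel_measurable_lebesgue_integral[OF joint] by simp
  then have *: "hausdorff_op \<Phi>' \<beta> f' \<in> borel_measurable lebesgue"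
    by (intro measurable_completion) simp
  have "AE x in lborel. AE y in lborel. hausdorff_integrand \<Phi> \<beta> f x y = hausdorff_integrand \<Phi>' \<beta> f' x y"
    by (rule AE_lborel_rayI[OF hausdorff_integrand_cong_AE[OF \<Phi>' f']])
  then have "AE x in lborel. hausdorff_op \<Phi>' \<beta> f' x = hausdorff_op \<Phi> \<beta> f x"
  proof eventually_elim
    case (elim x)
    have m: "hausdorff_integrand \<Phi>' \<beta> f' x \<in> borel_measurable lebesgue"
      using h' by (intro measurable_completion) simp
    have ae: "AE y in lebesgue. hausdorff_integrand \<Phi>' \<beta> f' x y = hausdorff_integrand \<Phi> \<beta> f x y"
      using elim unfolding AE_completion_iff by eventually_elim simp
    show ?case
      unfolding hausdorff_op_def by (rule integral_cong_AE[OF m borel_measurable_AE[OF m ae] ae])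
  qed
  then show ?thesis
    by (intro borel_measurable_AE[OF *]) (simp add: AE_completion_iff)
qed

section \<open>From the pointwise bound to the weak mixed norm\<close>

lemma nn_integral_powr_Icc:
  assumes "a > -1" "0 \<le> R"
  shows "(\<integral>\<^sup>+r\<in>{0..R}. ennreal (r powr a) \<partial>lborel) = ennreal (R powr (a + 1) / (a + 1))"
  using assms by (intro nn_integral_has_integral_lebesgue' has_integral_powr_from_0) auto

lemma weak_mixed_norm_le:
  fixes g :: "'a::euclidean_space \<Rightarrow> complex"
  assumes p: "1 \<le> p" and q: "1 \<le> q" and \<gamma>: "real DIM('a) + \<gamma> > 0" and C: "0 \<le> C"
    and g: "AE \<theta> in sphere_measure. \<forall>r>0. norm (g (r *\<^sub>R \<theta>)) \<le> r powr (- ((\<gamma> + real DIM('a)) / p)) * C"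
  shows "weak_mixed_norm p q (\<lambda>r. r powr \<gamma>) g
    \<le> ennreal (measure (surface_measure :: 'a measure) (sphere 0 1) powr (1 / q)
            / (real DIM('a) + \<gamma>) powr (1 / p)) * ennreal C"
proof -
  let ?n = "real DIM('a)"
  define \<omega> where "\<omega> = measure (surface_measure :: 'a measure) (sphere 0 1)"
  have S: "sphere 0 1 \<in> sets (sphere_measure :: 'a measure)"
    by (metis sets.top space_sphere_measure)
  have \<omega>: "emeasure (sphere_measure :: 'a measure) (sphere 0 1) = ennreal \<omega>" "\<omega> \<ge> 0"
    using emeasure_sphere_measure_finite[where 'a='a] S
    by (simp_all add: \<omega>_def surface_measure_eq measure_def main_part_sets)
  define c where "c = (\<gamma> + ?n) / p"
  have c: "c > 0" using p \<gamma> by (simp add: c_def)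
  have "ennreal l * mixed_norm p q (\<lambda>r. r powr \<gamma>) (indicator {x. norm (g x) > l} :: 'a \<Rightarrow> real)
      \<le> ennreal (\<omega> powr (1 / q) / (?n + \<gamma>) powr (1 / p)) * ennreal C" if l: "l > 0" for l
  proof -
    \<comment> \<open>\<open>R\<close> solves R^(-c) C = l. For \<open>C = 0\<close> the convention
      \<open>0 powr a = 0\<close> gives \<open>R = 0\<close>, as it should.\<close>
    define R where "R = (C / l) powr (1 / c)"
    let ?A = "indicator {x. norm (g x) > l} :: 'a \<Rightarrow> real"
    \<comment> \<open>Because the exceptional directions are the same for all radii, this holds on
      every sphere: the slice has at most full measure, and measure zero beyond
      \<open>R\<close>.\<close>
    have inner: "(\<integral>\<^sup>+\<theta>. ennreal (norm (?A (r *\<^sub>R \<theta>)) powr q) \<partial>surface_measure) \<le> ennreal \<omega> * indicator {0..R} r"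
      if r: "r > 0" for r
    proof -
      have "(\<integral>\<^sup>+\<theta>. ennreal (norm (?A (r *\<^sub>R \<theta>)) powr q) \<partial>surface_measure)
          \<le> (\<integral>\<^sup>+(\<theta>::'a). indicator {0..R} r \<partial>sphere_measure)"
        unfolding surface_measure_eq nn_integral_completion
      proof (rule nn_integral_mono_AE)
        show "AE \<theta> in sphere_measure. ennreal (norm (?A (r *\<^sub>R \<theta>)) powr q) \<le> indicator {0..R} r"
          using g
        proof eventually_elim
          case (elim \<theta>)
          show ?case
          proof (cases "norm (g (r *\<^sub>R \<theta>)) > l")
            case True
            with elim r have "l < r powr (- c) * C" by (force simp: c_def)
            then have "r powr c \<le> C / l"
              using r l by (simp add: powr_minus field_simps)
            then have "(r powr c) powr (1 / c) \<le> R"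
              unfolding R_def using c by (intro powr_mono2) auto
            then have "r \<le> R" using r c by (simp add: powr_powr)
            with True r show ?thesis by (simp add: indicator_def)
          qed (simp add: indicator_def)
        qed
      qed
      also have "\<dots> = ennreal \<omega> * indicator {0..R} r"
        by (simp add: \<omega> mult.commute)
      finally show ?thesis .
    qed
    have "(\<integral>\<^sup>+r\<in>{0<..}. enn_powr (\<integral>\<^sup>+\<theta>. ennreal (norm (?A (r *\<^sub>R \<theta>)) powr q) \<partial>surface_measure) (p / q)
            * ennreal (r ^ (DIM('a) - 1) * r powr \<gamma>) \<partial>lebesgue)
        \<le> (\<integral>\<^sup>+r. ennreal (\<omega> powr (p / q)) * (ennreal (r powr (?n - 1 + \<gamma>)) * indicator {0..R} r) \<partial>lborel)"
      unfolding nn_integral_completion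
    proof (rule nn_integral_mono)
      fix r :: real
      show "enn_powr (\<integral>\<^sup>+\<theta>. ennreal (norm (?A (r *\<^sub>R \<theta>)) powr q) \<partial>surface_measure) (p / q)
            * ennreal (r ^ (DIM('a) - 1) * r powr \<gamma>) * indicator {0<..} r
          \<le> ennreal (\<omega> powr (p / q)) * (ennreal (r powr (?n - 1 + \<gamma>)) * indicator {0..R} r)"
      proof (cases "r > 0")
        case True
        have "enn_powr (\<integral>\<^sup>+\<theta>. ennreal (norm (?A (r *\<^sub>R \<theta>)) powr q) \<partial>surface_measure) (p / q)
            \<le> enn_powr (ennreal \<omega> * indicator {0..R} r) (p / q)"
          using p q by (intro enn_powr_mono inner True) auto
        also have "\<dots> = ennreal (\<omega> powr (p / q)) * indicator {0..R} r"
          using \<omega> by (auto simp: indicator_def enn_powr_ennreal)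
        finally have "enn_powr (\<integral>\<^sup>+\<theta>. ennreal (norm (?A (r *\<^sub>R \<theta>)) powr q) \<partial>surface_measure) (p / q)
            * ennreal (r ^ (DIM('a) - 1) * r powr \<gamma>)
            \<le> ennreal (\<omega> powr (p / q)) * indicator {0..R} r * ennreal (r ^ (DIM('a) - 1) * r powr \<gamma>)"
          by (rule mult_right_mono) simp
        moreover have "r ^ (DIM('a) - 1) * r powr \<gamma> = r powr (?n - 1 + \<gamma>)"
          using True by (simp add: powr_realpow[symmetric] of_nat_diff Suc_leI flip: powr_add)
        ultimately show ?thesis
          using True by (simp add: mult_ac)
      qed simp
    qed
    also have "\<dots> = ennreal (\<omega> powr (p / q)) * ennreal (R powr (?n - 1 + \<gamma> + 1) / (?n - 1 + \<gamma> + 1))"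
      using \<gamma> by (subst nn_integral_powr_Icc[symmetric]) (auto simp: R_def intro!: nn_integral_cmult)
    \<comment> \<open>Since (n+\<gamma>)/c = p, with n the dimension, the level enters as the p-th
      power of \<open>C / l\<close>, whose root cancels the factor \<open>l\<close> of the weak
      norm.\<close>
    also have "R powr (?n - 1 + \<gamma> + 1) = (C / l) powr p"
      using \<gamma> p by (simp add: R_def c_def powr_powr add.commute)
    finally have "mixed_norm p q (\<lambda>r. r powr \<gamma>) ?A
        \<le> enn_powr (ennreal (\<omega> powr (p / q)) * ennreal ((C / l) powr p / (?n + \<gamma>))) (1 / p)"
      unfolding mixed_norm_def using p by (intro enn_powr_mono) simp_all
    also have "\<dots> = ennreal (\<omega> powr (1 / q) / (?n + \<gamma>) powr (1 / p) * (C / l))"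
    proof -
      have "(\<omega> powr (p / q) * ((C / l) powr p / (?n + \<gamma>))) powr (1 / p)
          = \<omega> powr (1 / q) / (?n + \<gamma>) powr (1 / p) * (C / l)"
        using p \<gamma> C l by (simp add: powr_mult powr_divide powr_powr)
      then show ?thesis
        using \<gamma> by (simp add: enn_powr_ennreal flip: ennreal_mult)
    qed
    finally have "ennreal l * mixed_norm p q (\<lambda>r. r powr \<gamma>) ?A
        \<le> ennreal l * ennreal (\<omega> powr (1 / q) / (?n + \<gamma>) powr (1 / p) * (C / l))"
      by (rule mult_left_mono) simp
    also have "\<dots> = ennreal (\<omega> powr (1 / q) / (?n + \<gamma>) powr (1 / p)) * ennreal C"
      using l C by (simp flip: ennreal_mult)
    finally show ?thesis .
  qed
  then show ?thesis
    unfolding weak_mixed_norm_def \<omega>_def by (intro SUP_least) auto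
qed

text \<open>The Bochner integral of a non-integrable function is 0 by convention. The first two
  conjuncts ensure that the norm bound speaks of a genuine, measurable operator value at almost
  every point.\<close>

theorem theorem3p2:
  fixes \<Phi> f :: "real ^ 'n \<Rightarrow> complex"
    and n :: nat
    and \<alpha> \<beta> \<gamma> p1 p2 q :: real
  assumes "CARD('n) = n" and "n \<ge> 2"
    and "0 \<le> \<beta>" and "\<beta> < real n"
    and "1 \<le> p1" and "1 \<le> p2" and "1 \<le> q"
    and "real n + \<gamma> > 0"
    and "(\<gamma> + real n) / p2 = (\<alpha> + real n) / p1 - \<beta>"
    and "\<Phi> \<in> borel_measurable lebesgue"
    and "f \<in> borel_measurable lebesgue"
    and "kernel_norm p1 p2 \<gamma> \<Phi> * mixed_norm p1 1 (\<lambda>r. r powr \<alpha>) f < \<infinity>"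
  shows "(AE x in lebesgue. integrable lebesgue (hausdorff_integrand \<Phi> \<beta> f x))
    \<and> hausdorff_op \<Phi> \<beta> f \<in> borel_measurable lebesgue
    \<and> weak_mixed_norm p2 q (\<lambda>r. r powr \<gamma>) (hausdorff_op \<Phi> \<beta> f)
      \<le> ennreal (measure (surface_measure :: (real ^ 'n) measure) (sphere 0 1) powr (1 / q)
            / (real n + \<gamma>) powr (1 / p2))
        * kernel_norm p1 p2 \<gamma> \<Phi> * mixed_norm p1 1 (\<lambda>r. r powr \<alpha>) f"
proof -
  have n: "DIM(real ^ 'n) = n"
    using assms(1) by simp
  \<comment> \<open>Only the product of the two norms is known to be finite: one factor may be
    infinite if the other is 0. Hence \<open>C\<close> stands for the product.\<close>
  obtain C where C: "kernel_norm p1 p2 \<gamma> \<Phi> * mixed_norm p1 1 (\<lambda>r. r powr \<alpha>) f = ennreal C" "0 \<le> C"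
    using assms(12) by (cases "kernel_norm p1 p2 \<gamma> \<Phi> * mixed_norm p1 1 (\<lambda>r. r powr \<alpha>) f") auto
  have "AE \<theta> in sphere_measure. \<forall>r>0. hausdorff_integrand \<Phi> \<beta> f (r *\<^sub>R \<theta>) \<in> borel_measurable lebesgue \<and>
    (\<integral>\<^sup>+y. ennreal (norm (hausdorff_integrand \<Phi> \<beta> f (r *\<^sub>R \<theta>) y)) \<partial>lebesgue)
      \<le> ennreal (r powr (- ((\<gamma> + real n) / p2))) * ennreal C"
    using hausdorff_integrand_ray_bound[of p1 \<gamma> p2 \<alpha> \<beta> \<Phi> f] assms unfolding n C(1) by simp
  then have ray: "AE \<theta> in sphere_measure. \<forall>r>0. integrable lebesgue (hausdorff_integrand \<Phi> \<beta> f (r *\<^sub>R \<theta>))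
      \<and> norm (hausdorff_op \<Phi> \<beta> f (r *\<^sub>R \<theta>)) \<le> r powr (- ((\<gamma> + real n) / p2)) * C"
  proof eventually_elim
    case (elim \<theta>)
    show ?case
    proof (intro allI impI)
      fix r :: real assume "r > 0"
      let ?h = "hausdorff_integrand \<Phi> \<beta> f (r *\<^sub>R \<theta>)"
      have h: "?h \<in> borel_measurable lebesgue"
        and le: "(\<integral>\<^sup>+y. ennreal (norm (?h y)) \<partial>lebesgue) \<le> ennreal (r powr (- ((\<gamma> + real n) / p2)) * C)"
        using elim \<open>r > 0\<close> C(2) by (auto simp: ennreal_mult)
      have int: "integrable lebesgue ?h"
        using h le by (intro integrableI_bounded) (auto intro: le_less_trans)
      have "ennreal (norm (hausdorff_op \<Phi> \<beta> f (r *\<^sub>R \<theta>))) \<le> ennreal (r powr (- ((\<gamma> + real n) / p2)) * C)"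
        unfolding hausdorff_op_def using integral_norm_bound_ennreal[OF int] le by (rule order_trans)
      with int C(2) show "integrable lebesgue ?h \<and>
          norm (hausdorff_op \<Phi> \<beta> f (r *\<^sub>R \<theta>)) \<le> r powr (- ((\<gamma> + real n) / p2)) * C"
        by (simp add: ennreal_le_iff)
    qed
  qed
  have "AE x in lborel. integrable lebesgue (hausdorff_integrand \<Phi> \<beta> f x)"
    using ray by (intro AE_lborel_rayI) (auto elim!: eventually_mono)
  moreover have "hausdorff_op \<Phi> \<beta> f \<in> borel_measurable lebesgue"
    using assms by (intro borel_measurable_hausdorff_op)
  moreover have "weak_mixed_norm p2 q (\<lambda>r. r powr \<gamma>) (hausdorff_op \<Phi> \<beta> f)
      \<le> ennreal (measure (surface_measure :: (real ^ 'n) measure) (sphere 0 1) powr (1 / q)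
            / (real DIM(real ^ 'n) + \<gamma>) powr (1 / p2)) * ennreal C"
    using ray assms C(2) by (intro weak_mixed_norm_le) (auto elim!: eventually_mono)
  ultimately show ?thesis
    unfolding n C(1)[symmetric] by (simp add: AE_completion_iff mult.assoc)
qed

end
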